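(* Let $n$ be a positive integer, let $b,\gamma$ be nonzero complex numbers with $|\arg b|<\pi$, $|\arg\gamma|<\pi$ and $b\neq\gamma$, and let $k$ and $a\neq 0$ be complex parameters. Let $m$ be a complex number with $0<\operatorname{Re}(m)<1$ and $0<\operatorname{Im}(m)<1$. Then $$ \begin{aligned} \int_0^{\infty } \frac{x^{m-1} \log ^k(a x)}{(b+x) (x+\gamma )^n} \, dx ={}& b^{m-1} (-1)^{m+1} (2 i\pi )^{k+1} (\gamma -b)^{-n}\, \Phi \left(e^{2 i \pi m },-k,-\frac{i (i \pi +\log (a)+\log (b))}{2 \pi }\right)\\ &+\sum _{j=0}^{n-1} \sum _{p=0}^j \sum _{l=0}^p \sum _{h=0}^{p-l} \frac{(-1)^{j-l} (-1)^m\, m^{p-l-h}\, (2 i\pi )^{1-h+k}\, \gamma ^{m-1} (\gamma -b)^{-n} \left(\frac{\gamma -b}{\gamma }\right)^j}{j!} \binom{p}{l} \binom{p-l}{h}\\ &\qquad\times (1-h+k)_h\, \Phi \left(e^{2 i \pi m },h-k,-\frac{i (i \pi +\log (a)+\log (\gamma ))}{2 \pi }\right) S_j^{(p)} . \end{aligned} $$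
   Context: Here $\log^k(ax)=(\log(ax))^k$ with $\log(ax)=\log a+\log x$ for $x>0$; logarithms and non-integer powers denote principal values, so that $(-1)^m=e^{i\pi m}$ and $(-1)^{m+1}=-e^{i\pi m}$. $\Phi(z,s,v)$ is the Hurwitz-Lerch zeta function, $\Phi(z,s,v)=\sum_{q=0}^{\infty} z^q (q+v)^{-s}$ for $|z|<1$ and $v\neq 0,-1,-2,\dots$; here $|e^{2 i\pi m}|<1$ because $\operatorname{Im}(m)>0$. $(c)_h=c(c+1)\cdots(c+h-1)$, with $(c)_0=1$, is the Pochhammer symbol. $S_j^{(p)}$ is the signed Stirling number of the first kind, defined by $y(y-1)\cdots(y-j+1)=\sum_{p=0}^{j} S_j^{(p)} y^p$, with $S_0^{(0)}=1$.
   Formalization: Added assumptions: Im(a) ≥ 0 or k is a nonnegative integer (the identity fails otherwise, e.g. k = −1, a = −i); Re(k) > −1 when a is a positive real (else the integral diverges); and the third arguments of Φ are not 0, −1, −2, … *)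

theory Defs
  imports "HOL-Analysis.Analysis" "HOL-Computational_Algebra.Polynomial"
begin

text \<open>
  The Hurwitz-Lerch zeta function, as the series for \<open>\<bar>z\<bar> < 1\<close> and \<open>v\<close> not a
  non-positive integer; \<open>powr\<close> is the principal power.
\<close>

definition hurwitz_lerch :: "complex \<Rightarrow> complex \<Rightarrow> complex \<Rightarrow> complex" where
  "hurwitz_lerch z s v = (\<Sum>q. z ^ q * (of_nat q + v) powr (- s))"

text \<open>
  Signed Stirling numbers of the first kind (the library's \<open>stirling\<close> is unsigned):
  the coefficient of \<open>y ^ p\<close> in \<open>y (y - 1) \<cdots> (y - j + 1)\<close>.
\<close>

definition signed_stirling1 :: "nat \<Rightarrow> nat \<Rightarrow> int" where
  "signed_stirling1 j p = coeff (\<Prod>i<j. [:- int i, 1:]) p"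

lemma signed_stirling1_falling_factorial:
  "(\<Prod>i<j. y - int i) = (\<Sum>p\<le>j. signed_stirling1 j p * y ^ p)"
proof -
  let ?P = "\<Prod>i<j. [:- int i, 1:]"
  have "degree ?P = j"
    by (subst degree_prod_eq_sum_degree) auto
  moreover have eq: "poly ?P y = (\<Prod>i<j. y - int i)"
    by (simp add: poly_prod)
  ultimately show ?thesis
    by (simp add: signed_stirling1_def poly_altdef flip: eq)
qed

text \<open>
  The integrand. \<open>log\<^sup>k (a x)\<close> is \<open>(log a + log x)\<^sup>k\<close>, principal values throughout.
\<close>

definition log_integrand ::
  "nat \<Rightarrow> complex \<Rightarrow> complex \<Rightarrow> complex \<Rightarrow> complex \<Rightarrow> complex \<Rightarrow> real \<Rightarrow> complex" where
  "log_integrand n b \<gamma> k a m x =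
     complex_of_real x powr (m - 1) * (ln a + complex_of_real (ln x)) powr k /
     ((b + complex_of_real x) * (complex_of_real x + \<gamma>) ^ n)"

end

theory Submission
  imports Defs "HOL-Complex_Analysis.Complex_Analysis"
begin

text \<open>
  The substitution \<open>x = e\<^sup>t\<close> turns the integral into the integral over the real line of
  \<open>f t = e\<^bsup>m t\<^esup> (t + log a)\<^sup>k / ((b + e\<^sup>t) (e\<^sup>t + \<gamma>)\<^sup>n)\<close>. If \<open>Im a \<ge> 0\<close>, then \<open>t + log a\<close>
  maps the upper half-plane into itself and never meets the cut of the principal power; if \<open>k\<close> is a
  natural number, the power is a polynomial. Either way \<open>f\<close> is meromorphic above the real
  line, with poles at \<open>log b + i \<pi> (2 q + 1)\<close> and \<open>log \<gamma> + i \<pi> (2 q + 1)\<close>, \<open>q = 0, 1, 2, \<dots>\<close>.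
  Since \<open>Im m > 0\<close>, the factor \<open>e\<^bsup>m t\<^esup>\<close> decays upwards, so the integral over the real line is
  \<open>2 \<pi> i\<close> times the sum of all residues. From one pole to the next, \<open>e\<^bsup>m t\<^esup>\<close> gains the factor
  \<open>e\<^bsup>2 \<pi> i m\<^esup>\<close> and \<open>t + log a = 2 \<pi> i (q + v)\<close> moves by \<open>2 \<pi> i\<close>; that is exactly the shape
  of a Hurwitz-Lerch series in \<open>q\<close>.

  The pole of order \<open>n\<close> is first split off by partial fractions
  (\<open>partial_fraction_repeated_pole\<close>), which leaves kernels \<open>1 / (e\<^sup>t + c)\<^bsup>j + 1\<^esup>\<close>
  with a single family of poles. Integration by parts around the pole
  (\<open>has_contour_integral_exp_pole\<close>) lowers the order at the price of the operator
  \<open>e\<^bsup>-t\<^esup> d/dt\<close>, which is \<open>d/dx\<close> in the original variable. Its \<open>j\<close>-th power is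
  \<open>e\<^bsup>-j t\<^esup> D (D - 1) \<cdots> (D - j + 1)\<close> with \<open>D = d/dt\<close>: the Stirling numbers expand the falling
  factorial, the Leibniz rule differentiates \<open>e\<^bsup>(m - 1) t\<^esup> (t + log a)\<^sup>k\<close>, and the powers of
  \<open>m - 1\<close> are expanded into powers of \<open>m\<close>. These are the sums over \<open>p\<close>, \<open>h\<close> and \<open>l\<close>.

  The analysis is in \<open>line_integral_sums_residues\<close>. For positive \<open>a\<close> the integrand may be
  singular on the real line, at \<open>t = - log a\<close>; therefore the residues are collected above a line
  \<open>Im t = \<epsilon>\<close>, where everything is smooth, and \<open>\<epsilon>\<close> tends to \<open>0\<close> by dominated convergence.
\<close>

section \<open>Estimates for the exponential kernel\<close>

text \<open>
  A number of argument at most \<open>\<theta> < \<pi>\<close> cannot cancel a positive real number: the square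
  of the left-hand side falls short of the square of the norm by at least
  \<open>(x - r)\<^sup>2 (1 - cos \<theta>) / 2\<close>.
\<close>

lemma norm_real_plus_rcis_ge:
  assumes "0 \<le> x" "0 \<le> r" "\<bar>\<phi>\<bar> \<le> \<theta>" "\<theta> \<le> pi"
  shows "cos (\<theta> / 2) * (x + r) \<le> norm (complex_of_real x + rcis r \<phi>)"
proof (rule power2_le_imp_le)
  have c: "cos \<theta> \<le> cos \<phi>"
    using assms by (metis abs_ge_zero cos_abs_real cos_mono_le_eq order_trans)
  have half: "(cos (\<theta> / 2))\<^sup>2 = (1 + cos \<theta>) / 2"
    using cos_squared_eq[of "\<theta> / 2"] cos_double_cos[of "\<theta> / 2"] by simp
  have "(norm (complex_of_real x + rcis r \<phi>))\<^sup>2 = (x + r * cos \<phi>)\<^sup>2 + (r * sin \<phi>)\<^sup>2"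
    by (simp add: cmod_power2)
  also have "\<dots> = x\<^sup>2 + 2 * x * r * cos \<phi> + r\<^sup>2 * ((cos \<phi>)\<^sup>2 + (sin \<phi>)\<^sup>2)"
    by (simp only: power2_eq_square) algebra
  finally have n: "(norm (complex_of_real x + rcis r \<phi>))\<^sup>2 = x\<^sup>2 + 2 * x * r * cos \<phi> + r\<^sup>2"
    by simp
  have "(x + r)\<^sup>2 * (1 + cos \<theta>) / 2 + (x - r)\<^sup>2 * (1 - cos \<theta>) / 2 = x\<^sup>2 + 2 * x * r * cos \<theta> + r\<^sup>2"
    by (simp add: power2_eq_square field_simps)
  moreover have "0 \<le> (x - r)\<^sup>2 * (1 - cos \<theta>) / 2" by simp
  moreover have "2 * x * r * cos \<theta> \<le> 2 * x * r * cos \<phi>"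
    using c assms by (intro mult_left_mono) auto
  ultimately show "(cos (\<theta> / 2) * (x + r))\<^sup>2 \<le> (norm (complex_of_real x + rcis r \<phi>))\<^sup>2"
    unfolding n power_mult_distrib half times_divide_eq_left mult.commute[of "1 + cos \<theta>"]
    by linarith
qed simp

text \<open>
  Dividing \<open>e\<^sup>t + \<gamma>\<close> by \<open>e\<^bsup>i Im t\<^esup>\<close> rotates \<open>\<gamma>\<close> only slightly when \<open>Im t\<close> is at or
  just above a multiple of \<open>2 \<pi>\<close>, so its argument stays away from \<open>\<plusminus>\<pi>\<close>. The constant serves
  all these lines at once, which is needed both for \<open>\<epsilon> \<rightarrow> 0\<close> and for \<open>Im t \<rightarrow> \<infinity>\<close>.
\<close>

lemma exp_plus_lower_bound_on_lines:
  fixes \<gamma> :: complex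
  assumes "\<gamma> \<noteq> 0" "\<bar>Arg \<gamma>\<bar> < pi"
  obtains c where "0 < c"
    "\<And>t q. \<lbrakk>2 * pi * real q \<le> Im t; Im t \<le> (pi - \<bar>Arg \<gamma>\<bar>) / 2 + 2 * pi * real q\<rbrakk> \<Longrightarrow>
       c * (1 + exp (Re t)) \<le> norm (exp t + \<gamma>)"
proof -
  define \<theta> where "\<theta> = (pi + \<bar>Arg \<gamma>\<bar>) / 2"
  have \<theta>: "0 \<le> \<theta>" "\<theta> < pi" using assms by (auto simp: \<theta>_def)
  have cpos: "0 < cos (\<theta> / 2)" using \<theta> by (intro cos_gt_zero_pi) auto
  define c where "c = cos (\<theta> / 2) * min 1 (norm \<gamma>)"
  show ?thesis
  proof (rule that[of c])
    show "0 < c" using cpos assms by (simp add: c_def)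
  next
    fix t q assume t: "2 * pi * real q \<le> Im t" "Im t \<le> (pi - \<bar>Arg \<gamma>\<bar>) / 2 + 2 * pi * real q"
    define v where "v = Im t - 2 * pi * real q"
    have v: "0 \<le> v" "v \<le> (pi - \<bar>Arg \<gamma>\<bar>) / 2" using t unfolding v_def by linarith+
    have "cis (Im t) = cis (v + 2 * pi * real q)" by (simp add: v_def)
    also have "\<dots> = cis v * cis (2 * pi * real q)" by (simp only: cis_mult)
    also have "cis (2 * pi * real q) = 1" by (intro cis_multiple_2pi) auto
    finally have "cis (Im t) = cis v" by simp
    hence e: "exp t = of_real (exp (Re t)) * cis v" by (simp add: exp_eq_polar)
    have "exp t + \<gamma> = cis v * (of_real (exp (Re t)) + rcis (norm \<gamma>) (Arg \<gamma> - v))"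
      unfolding e using rcis_cmod_Arg[of \<gamma>]
      by (simp add: rcis_def ring_distribs cis_mult mult.left_commute[of "cis v"])
    hence "norm (exp t + \<gamma>) = norm (of_real (exp (Re t)) + rcis (norm \<gamma>) (Arg \<gamma> - v))"
      by (simp add: norm_mult)
    also have "\<dots> \<ge> cos (\<theta> / 2) * (exp (Re t) + norm \<gamma>)"
    proof (rule norm_real_plus_rcis_ge)
      show "\<bar>Arg \<gamma> - v\<bar> \<le> \<theta>" using v assms(2) unfolding \<theta>_def by (intro abs_leI; argo)
    qed (use \<theta> in auto)
    also have "cos (\<theta> / 2) * (exp (Re t) + norm \<gamma>) \<ge> c * (1 + exp (Re t))"
    proof -
      have "min 1 (norm \<gamma>) * (1 + exp (Re t)) = min 1 (norm \<gamma>) + min 1 (norm \<gamma>) * exp (Re t)"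
        by (simp add: algebra_simps)
      also have "\<dots> \<le> norm \<gamma> + 1 * exp (Re t)"
        by (intro add_mono mult_right_mono) auto
      finally show ?thesis
        using cpos by (simp add: c_def mult.assoc add.commute mult_left_mono)
    qed
    finally show "c * (1 + exp (Re t)) \<le> norm (exp t + \<gamma>)" .
  qed
qed

text \<open>
  Far to the left and to the right one of the two summands dominates, whatever \<open>Im t\<close> is. This
  controls the vertical sides of the rectangles.
\<close>

lemma exp_plus_lower_bound_far_out:
  fixes \<gamma> :: complex
  assumes "\<gamma> \<noteq> 0" "\<bar>Re t\<bar> \<ge> ln 2 + \<bar>ln (norm \<gamma>)\<bar>"
  shows "min 1 (norm \<gamma>) / 4 * (1 + exp (Re t)) \<le> norm (exp t + \<gamma>)"
proof -
  define E where "E = exp (Re t)"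
  have E0: "E > 0" by (simp add: E_def)
  have "norm (exp t) = E" by (simp add: E_def)
  have "min 1 (norm \<gamma>) / 4 * (1 + E) = min 1 (norm \<gamma>) / 4 + min 1 (norm \<gamma>) / 4 * E"
    by (simp add: algebra_simps)
  also have "\<dots> \<le> norm \<gamma> / 4 + 1 / 4 * E"
    using E0 by (intro add_mono mult_right_mono) auto
  finally have le: "min 1 (norm \<gamma>) / 4 * (1 + E) \<le> norm \<gamma> / 4 + E / 4" by simp
  have g: "norm \<gamma> = exp (ln (norm \<gamma>))" using assms by simp
  have "E \<ge> 2 * norm \<gamma> \<or> norm \<gamma> \<ge> 2 * E"
  proof (cases "Re t \<ge> 0")
    case True
    hence "ln 2 + ln (norm \<gamma>) \<le> Re t" using assms by linarith
    hence "exp (ln 2 + ln (norm \<gamma>)) \<le> E" unfolding E_def by simp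
    thus ?thesis using assms by (simp add: exp_add)
  next
    case False
    hence "ln 2 + Re t \<le> ln (norm \<gamma>)" using assms by linarith
    hence "exp (ln 2 + Re t) \<le> norm \<gamma>" by (subst g) simp
    thus ?thesis by (simp add: exp_add E_def)
  qed
  moreover have "norm (exp t + \<gamma>) \<ge> E - norm \<gamma>" "norm (exp t + \<gamma>) \<ge> norm \<gamma> - E"
    using norm_diff_ineq[of "exp t" \<gamma>] norm_diff_ineq[of \<gamma> "exp t"] \<open>norm (exp t) = E\<close>
    by (auto simp: add.commute)
  ultimately show ?thesis
    using le E0 norm_ge_zero[of \<gamma>] unfolding E_def[symmetric] by linarith
qed

text \<open>
  Where \<open>e\<^sup>t + \<gamma>\<close> is bounded below by \<open>1 + e\<^bsup>Re t\<^esup>\<close>, the condition \<open>0 < Re m < 1\<close> gives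
  exponential decay in both horizontal directions: \<open>e\<^bsup>Re m Re t\<^esup>\<close> alone decays to the left, and
  divided by \<open>e\<^bsup>Re t\<^esup>\<close> it decays to the right.
\<close>

lemma norm_exp_kernel_le:
  fixes \<gamma> m t :: complex
  assumes c: "0 < c" "c * (1 + exp (Re t)) \<le> norm (exp t + \<gamma>)"
    and m: "0 < Re m" "Re m < 1"
  shows "norm (exp (m * t) / (exp t + \<gamma>) ^ Suc j)
           \<le> exp (- (Im m * Im t)) * exp (- (min (Re m) (1 - Re m) * \<bar>Re t\<bar>)) / c ^ Suc j"
proof -
  define u where "u = Re t"
  define E where "E = 1 + exp u"
  have E: "E \<ge> 1" "E > 0" by (auto simp: E_def intro: add_pos_pos)
  have "(c * E) ^ Suc j \<le> norm (exp t + \<gamma>) ^ Suc j"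
    using c E by (intro power_mono) (auto simp: E_def u_def)
  moreover have "c ^ Suc j * E \<le> (c * E) ^ Suc j"
    unfolding power_mult_distrib using c E self_le_power[of E "Suc j"]
    by (intro mult_left_mono) auto
  ultimately have den: "c ^ Suc j * E \<le> norm ((exp t + \<gamma>) ^ Suc j)"
    by (simp only: norm_power)
  have decay: "exp (Re m * u) / E \<le> exp (- (min (Re m) (1 - Re m) * \<bar>u\<bar>))"
  proof (cases "u \<ge> 0")
    case True
    have "exp (Re m * u) / E \<le> exp (Re m * u) / exp u"
      using E by (intro divide_left_mono mult_pos_pos) (auto simp: E_def)
    also have "\<dots> = exp (- ((1 - Re m) * u))" by (simp add: algebra_simps flip: exp_diff)
    also have "\<dots> \<le> exp (- (min (Re m) (1 - Re m) * \<bar>u\<bar>))"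
      using True by (auto intro!: mult_right_mono)
    finally show ?thesis .
  next
    case False
    have "exp (Re m * u) / E \<le> exp (Re m * u) / 1"
      using E by (intro divide_left_mono) auto
    also have "\<dots> \<le> exp (- (min (Re m) (1 - Re m) * \<bar>u\<bar>))"
      using False by (auto intro!: mult_right_mono_neg simp: abs_if)
    finally show ?thesis .
  qed
  have "norm (exp (m * t) / (exp t + \<gamma>) ^ Suc j)
        \<le> exp (Re m * u - Im m * Im t) / (c ^ Suc j * E)"
    unfolding norm_divide using den c E
    by (intro frac_le) (auto simp: u_def)
  also have "\<dots> = exp (- (Im m * Im t)) * (exp (Re m * u) / E) / c ^ Suc j"
    by (simp add: exp_diff exp_minus field_simps)
  also have "\<dots> \<le> exp (- (Im m * Im t)) * exp (- (min (Re m) (1 - Re m) * \<bar>u\<bar>)) / c ^ Suc j"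
    using decay c by (intro divide_right_mono mult_left_mono) auto
  finally show ?thesis by (simp add: u_def)
qed

lemma integrable_exp_neg_abs:
  fixes \<delta> :: real
  assumes "\<delta> > 0"
  shows "integrable lborel (\<lambda>u. exp (- (\<delta> * \<bar>u\<bar>)))"
proof -
  have "(\<lambda>u. exp (- \<delta> * u)) integrable_on {0..}"
    using has_integral_exp_minus_to_infinity[OF assms, of 0] by blast
  hence "(\<lambda>u. exp (- \<delta> * u)) absolutely_integrable_on {0..}"
    by (intro nonnegative_absolutely_integrable_1) auto
  hence "integrable lebesgue (\<lambda>u. indicat_real {0..} u * exp (- \<delta> * u))"
    by (simp add: set_integrable_def)
  hence p: "integrable lborel (\<lambda>u. indicat_real {0..} u * exp (- \<delta> * u))"
    by (subst (asm) integrable_completion) auto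
  have "integrable lborel (\<lambda>u. indicat_real {0..} (0 + (-1) * u) * exp (- \<delta> * (0 + (-1) * u)))"
    by (rule lborel_integrable_real_affine[OF p]) auto
  from Bochner_Integration.integrable_add[OF p this]
  have s: "integrable lborel (\<lambda>u. indicat_real {0..} u * exp (- \<delta> * u)
                + indicat_real {0..} (- u) * exp (\<delta> * u))" by simp
  show ?thesis
    by (rule Bochner_Integration.integrable_bound[OF s]) (auto simp: indicator_def abs_if)
qed

text \<open>
  For positive \<open>r\<close> this is \<open>y \<le> e\<^sup>y\<close> at \<open>y = \<eta> x / r\<close>, raised to the power \<open>r\<close>; for
  other \<open>r\<close> the power does not increase. All growth and summability bounds for logarithmic powers below
  come from this estimate.
\<close>

lemma powr_le_exp:
  fixes r \<eta> \<epsilon> :: real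
  assumes "\<eta> > 0" "\<epsilon> > 0"
  obtains M where "M > 0" "\<And>x. x \<ge> \<epsilon> \<Longrightarrow> x powr r \<le> M * exp (\<eta> * x)"
proof (cases "r > 0")
  case True
  show ?thesis
  proof (rule that[of "(r / \<eta>) powr r"])
    show "(r / \<eta>) powr r > 0" using True assms by simp
  next
    fix x assume x: "x \<ge> \<epsilon>"
    have "x = (r / \<eta>) * (\<eta> * x / r)" using True assms by simp
    also have "\<dots> \<le> (r / \<eta>) * exp (\<eta> * x / r)"
      using True assms exp_ge_add_one_self[of "\<eta> * x / r"]
      by (intro mult_left_mono) (linarith, simp)
    finally have "x powr r \<le> ((r / \<eta>) * exp (\<eta> * x / r)) powr r"
      using True assms x by (intro powr_mono2) auto
    also have "\<dots> = (r / \<eta>) powr r * exp (\<eta> * x / r) powr r"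
      by (rule powr_mult)
    also have "exp (\<eta> * x / r) powr r = exp (\<eta> * x)"
      using True by (simp add: powr_def)
    finally show "x powr r \<le> (r / \<eta>) powr r * exp (\<eta> * x)" .
  qed
next
  case False
  show ?thesis
  proof (rule that[of "\<epsilon> powr r"])
    show "\<epsilon> powr r > 0" using assms by simp
  next
    fix x assume x: "x \<ge> \<epsilon>"
    have "x powr r \<le> \<epsilon> powr r" using False assms x by (intro powr_mono2') auto
    also have "\<dots> \<le> \<epsilon> powr r * exp (\<eta> * x)"
      using assms x by (simp add: mult_le_cancel_left1)
    finally show "x powr r \<le> \<epsilon> powr r * exp (\<eta> * x)" .
  qed
qed

text \<open>
  The complex logarithm is continuous off the closed negative real axis and, apart
  from \<open>0\<close>, the real logarithm of \<open>- z\<close> plus \<open>i \<pi>\<close> on it.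
\<close>

lemma borel_measurable_Ln [measurable (raw)]:
  fixes f :: "'a \<Rightarrow> complex"
  assumes [measurable]: "f \<in> borel_measurable M"
  shows "(\<lambda>x. Ln (f x)) \<in> borel_measurable M"
proof -
  have "Ln = (\<lambda>z. if z \<in> - \<real>\<^sub>\<le>\<^sub>0 then Ln z
                   else if z = 0 then Ln 0 else of_real (ln (- Re z)) + \<i> * pi)"
  proof
    fix z :: complex
    have "Ln z = of_real (ln (- Re z)) + \<i> * pi" if "z \<in> \<real>\<^sub>\<le>\<^sub>0" "z \<noteq> 0"
    proof -
      have "z = of_real (Re z)" "Re z < 0"
        using that by (auto simp: complex_nonpos_Reals_iff complex_eq_iff)
      thus ?thesis using Ln_of_real'[of "Re z"] by (simp add: mult.commute)
    qed
    thus "Ln z = (if z \<in> - \<real>\<^sub>\<le>\<^sub>0 then Ln z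
                   else if z = 0 then Ln 0 else of_real (ln (- Re z)) + \<i> * pi)" by auto
  qed
  moreover have "(\<lambda>z. if z \<in> - \<real>\<^sub>\<le>\<^sub>0 then Ln z
        else if z = 0 then Ln 0 else of_real (ln (- Re z)) + \<i> * pi) \<in> borel_measurable borel"
    by (intro borel_measurable_continuous_on_if continuous_intros measurable_If_set) auto
  ultimately have [measurable]: "Ln \<in> borel_measurable borel" by simp
  show ?thesis by measurable
qed

lemma borel_measurable_powr_complex [measurable (raw)]:
  fixes f :: "'a \<Rightarrow> complex"
  assumes [measurable]: "f \<in> borel_measurable M"
  shows "(\<lambda>x. f x powr s) \<in> borel_measurable M"
  unfolding powr_def by measurable

section \<open>Contour integrals of kernels with a periodic pole\<close>

text \<open>
  The family \<open>X\<close> consists of the iterated derivatives of \<open>X 0\<close> with respect to \<open>x = e\<^sup>t\<close>.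
  The pole of order one is the residue theorem. A higher order is lowered by the total derivative
  of \<open>X 0 t / (e\<^sup>t + \<gamma>)\<^bsup>j + 1\<^esup>\<close>, whose integral over a closed path vanishes, so the residue of a
  pole of order \<open>j + 1\<close> never has to be computed from a Laurent expansion.
\<close>

lemma has_contour_integral_exp_pole:
  fixes X :: "nat \<Rightarrow> complex \<Rightarrow> complex"
  assumes S: "open S" "connected S" "t0 \<in> S"
    and pole: "\<And>t. t \<in> S \<Longrightarrow> exp t + \<gamma> = 0 \<longleftrightarrow> t = t0"
    and X: "\<And>i t. t \<in> S \<Longrightarrow> (X i has_field_derivative exp t * X (Suc i) t) (at t)"
    and p: "valid_path p" "pathfinish p = pathstart p" "path_image p \<subseteq> S - {t0}"
    and wind: "\<And>z. z \<notin> S \<Longrightarrow> winding_number p z = 0" "winding_number p t0 = 1"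
  shows "((\<lambda>t. exp t * X 0 t / (exp t + \<gamma>) ^ Suc j) has_contour_integral
           2 * pi * \<i> * X j t0 / fact j) p"
  using X
proof (induction j arbitrary: X)
  case (0 X)
  let ?f = "\<lambda>t. exp t * X 0 t / (exp t + \<gamma>)"
  have holX: "X 0 holomorphic_on S"
    unfolding holomorphic_on_open[OF S(1)] using "0" by blast
  have holf: "?f holomorphic_on (S - {t0})"
    by (intro holomorphic_intros holomorphic_on_subset[OF holX]) (use pole in auto)
  have "((\<lambda>w. exp w + \<gamma>) has_field_derivative exp t0) (at t0)"
    by (auto intro!: derivative_eq_intros)
  moreover have "exp t0 + \<gamma> = 0" using pole S by blast
  ultimately have "((\<lambda>w. (exp w + \<gamma>) / (w - t0)) \<longlongrightarrow> exp t0) (at t0)"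
    by (simp add: has_field_derivative_iff)
  \<comment> \<open>stated as a limit because \<open>X 0\<close> may vanish at the pole\<close>
  hence "((\<lambda>w. exp w * X 0 w / ((exp w + \<gamma>) / (w - t0))) \<longlongrightarrow> exp t0 * X 0 t0 / exp t0) (at t0)"
    using DERIV_isCont[OF "0"[OF S(3)]] isCont_def
    by (intro tendsto_intros) auto
  hence "((\<lambda>w. ?f w * (w - t0)) \<longlongrightarrow> X 0 t0) (at t0)" by simp
  hence res: "residue ?f t0 = X 0 t0"
    by (intro residue_simple'[OF S(1,3) holf])
  have "contour_integral p ?f = 2 * pi * \<i> * (\<Sum>q\<in>{t0}. winding_number p q * residue ?f q)"
    using S holf p wind by (intro Residue_theorem[of S]) auto
  moreover have "?f contour_integrable_on p"
    using S holf p by (intro contour_integrable_holomorphic_simple[of _ "S - {t0}"]) auto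
  ultimately show ?case
    using has_contour_integral_integral res wind by fastforce
next
  case (Suc j X)
  let ?h = "\<lambda>t. exp t + \<gamma>"
  have IH: "((\<lambda>t. exp t * X (Suc 0) t / ?h t ^ Suc j) has_contour_integral
               2 * pi * \<i> * X (Suc j) t0 / fact j) p"
    using Suc.IH[of "\<lambda>i. X (Suc i)"] Suc.prems by simp
  have "((\<lambda>t. X 0 t / ?h t ^ Suc j) has_field_derivative
          exp t * X (Suc 0) t / ?h t ^ Suc j - of_nat (Suc j) * (exp t * X 0 t / ?h t ^ Suc (Suc j))) (at t)"
    if "t \<in> S - {t0}" for t
  proof -
    define P where "P = ?h t ^ j"
    have h: "?h t \<noteq> 0" using pole that by blast
    hence P: "P \<noteq> 0" by (simp add: P_def)
    have "((\<lambda>t. ?h t ^ Suc j) has_field_derivative of_nat (Suc j) * P * exp t) (at t)"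
      by (rule derivative_eq_intros refl | simp add: P_def)+
    from DERIV_divide[OF Suc.prems[of t 0] this] h that
    have "((\<lambda>t. X 0 t / ?h t ^ Suc j) has_field_derivative
        (exp t * X (Suc 0) t * (?h t * P) - X 0 t * (of_nat (Suc j) * P * exp t)) / (?h t * P * (?h t * P))) (at t)"
      by (simp add: P_def del: of_nat_Suc)
    also have "(exp t * X (Suc 0) t * (?h t * P) - X 0 t * (of_nat (Suc j) * P * exp t)) / (?h t * P * (?h t * P))
        = exp t * X (Suc 0) t / (?h t * P) - of_nat (Suc j) * (exp t * X 0 t / (?h t * (?h t * P)))"
      using h P by (simp add: divide_simps del: of_nat_Suc) (simp add: algebra_simps del: of_nat_Suc)
    finally show ?thesis by (simp add: P_def del: of_nat_Suc)
  qed
  hence "((\<lambda>t. exp t * X (Suc 0) t / ?h t ^ Suc j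
             - of_nat (Suc j) * (exp t * X 0 t / ?h t ^ Suc (Suc j))) has_contour_integral 0) p"
    using contour_integral_primitive[of "S - {t0}" "\<lambda>t. X 0 t / ?h t ^ Suc j"] p
    by (metis (no_types, lifting) diff_self has_field_derivative_at_within)
  from has_contour_integral_diff[OF IH this]
  have "((\<lambda>t. of_nat (Suc j) * (exp t * X 0 t / ?h t ^ Suc (Suc j))) has_contour_integral
           2 * pi * \<i> * X (Suc j) t0 / fact j) p" by simp
  from has_contour_integral_lmul[OF this, of "1 / of_nat (Suc j)"]
  show ?case by (simp add: field_simps del: of_nat_Suc power_Suc)
qed

lemma has_contour_integral_linepath_same_Im:
  assumes "a < b" "continuous_on (closed_segment (Complex a v) (Complex b v)) f"
  shows "(f has_contour_integral integral {a..b} (\<lambda>u. f (Complex u v)))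
           (linepath (Complex a v) (Complex b v))"
proof -
  have lp: "linepath (Complex a v) (Complex b v)
             = (+) (\<i> * of_real v) \<circ> linepath (of_real a) (of_real b)"
    by (auto simp: fun_eq_iff linepath_def complex_eq_iff algebra_simps)
  have eq: "of_real u + \<i> * of_real v = Complex u v" for u v by (simp add: complex_eq_iff)
  have "continuous_on {a..b} (\<lambda>u. f (Complex u v))"
    by (rule continuous_on_compose2[OF assms(2)])
       (auto simp: Complex_eq closed_segment_same_Im closed_segment_eq_real_ivl \<open>a < b\<close> less_imp_le
             intro!: continuous_intros)
  hence "(\<lambda>u. f (Complex u v)) integrable_on {a..b}"
    by (rule integrable_continuous_real)
  thus ?thesis
    unfolding lp has_contour_integral_translate using assms(1)
    by (subst has_contour_integral_linepath_Reals_iff) (auto simp: eq integrable_integral)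
qed

text \<open>
  The vertical sides of the rectangles with corners \<open>-T + i v\<close> and \<open>T + i w\<close> vanish as
  \<open>T\<close> grows; only the two horizontal lines remain, the upper one traversed backwards.
\<close>

lemma horizontal_line_integrals_differ_by_residue:
  fixes f :: "complex \<Rightarrow> complex"
  assumes vw: "v < w"
    and cont: "\<And>T. T > R \<Longrightarrow> continuous_on (path_image (rectpath (Complex (-T) v) (Complex T w))) f"
    and rect: "\<And>T. T > R \<Longrightarrow> contour_integral (rectpath (Complex (-T) v) (Complex T w)) f = c"
    and decay: "\<eta> > 0" "\<And>t. \<lbrakk>\<bar>Re t\<bar> > R; v \<le> Im t; Im t \<le> w\<rbrakk> \<Longrightarrow> norm (f t) \<le> M * exp (- (\<eta> * \<bar>Re t\<bar>))"
    and int: "integrable lborel (\<lambda>u. f (Complex u v))" "integrable lborel (\<lambda>u. f (Complex u w))"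
  shows "(LINT u|lborel. f (Complex u v)) - (LINT u|lborel. f (Complex u w)) = c"
proof -
  define J where "J = (\<lambda>y T. integral {-T..T} (\<lambda>u. f (Complex u y)))"
  have J: "(\<lambda>n. J y (real n)) \<longlonglongrightarrow> (LINT u|lborel. f (Complex u y))"
    if i: "integrable lborel (\<lambda>u. f (Complex u y))" for y
  proof -
    have [measurable]: "(\<lambda>u. f (Complex u y)) \<in> borel_measurable lborel" using i by auto
    have "(\<lambda>n. LINT u|lborel. indicator {- real n..real n} u *\<^sub>R f (Complex u y))
            \<longlonglongrightarrow> (LINT u|lborel. f (Complex u y))"
    proof (rule integral_dominated_convergence)
      show "integrable lborel (\<lambda>u. norm (f (Complex u y)))" using i by (rule integrable_norm)
      show "AE u in lborel. (\<lambda>n. indicator {- real n..real n} u *\<^sub>R f (Complex u y)) \<longlonglongrightarrow> f (Complex u y)"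
      proof (rule AE_I2)
        fix u :: real
        have "eventually (\<lambda>n. \<bar>u\<bar> \<le> real n) sequentially"
          by (metis eventually_sequentiallyI le_nat_iff nat_ceiling_le_eq of_nat_0_le_iff of_nat_le_iff order_trans real_nat_ceiling_ge)
        hence "eventually (\<lambda>n. indicator {- real n..real n} u *\<^sub>R f (Complex u y) = f (Complex u y)) sequentially"
        proof eventually_elim
          case (elim n)
          thus ?case by (simp add: indicator_def abs_le_iff minus_le_iff)
        qed
        thus "(\<lambda>n. indicator {- real n..real n} u *\<^sub>R f (Complex u y)) \<longlonglongrightarrow> f (Complex u y)"
          by (rule tendsto_eventually)
      qed
    qed (auto simp: indicator_def)
    moreover have "(LINT u|lborel. indicator {- real n..real n} u *\<^sub>R f (Complex u y)) = J y (real n)" for n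
    proof -
      have "set_integrable lborel {- real n..real n} (\<lambda>u. f (Complex u y))"
        unfolding set_integrable_def by (intro integrable_mult_indicator i) auto
      from set_borel_integral_eq_integral(2)[OF this] show ?thesis
        by (simp add: J_def set_lebesgue_integral_def)
    qed
    ultimately show ?thesis by simp
  qed
  have M: "M \<ge> 0"
  proof -
    have "0 \<le> norm (f (Complex (\<bar>R\<bar> + 1) v))" by simp
    also have "\<dots> \<le> M * exp (- (\<eta> * \<bar>\<bar>R\<bar> + 1\<bar>))" using vw by (intro decay(2)[THEN order_trans]) auto
    finally show ?thesis by (simp add: zero_le_mult_iff)
  qed
  have bound: "norm (J v T - J w T - c) \<le> 2 * (M * exp (- (\<eta> * T)) * (w - v))" if T: "T > R" "T > 0" for T
  proof -
    let ?a = "Complex (-T) v" and ?b = "Complex T v" and ?c = "Complex T w" and ?d = "Complex (-T) w"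
    have rp: "rectpath ?a ?c = linepath ?a ?b +++ linepath ?b ?c +++ linepath ?c ?d +++ linepath ?d ?a"
      by (simp add: rectpath_def Let_def)
    have pi: "path_image (rectpath ?a ?c) = closed_segment ?a ?b \<union> closed_segment ?b ?c
                \<union> closed_segment ?c ?d \<union> closed_segment ?d ?a"
      by (simp add: rp path_image_join Un_assoc)
    have con: "continuous_on (closed_segment ?a ?b) f" "continuous_on (closed_segment ?b ?c) f"
      "continuous_on (closed_segment ?c ?d) f" "continuous_on (closed_segment ?d ?a) f"
      using cont[OF T(1)] unfolding pi by (auto elim: continuous_on_subset)
    hence con': "continuous_on (closed_segment ?d ?c) f" by (simp add: closed_segment_commute)
    note cint = con[THEN contour_integrable_continuous_linepath]
    have "c = contour_integral (linepath ?a ?b) f + contour_integral (linepath ?b ?c) f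
            + contour_integral (linepath ?c ?d) f + contour_integral (linepath ?d ?a) f"
      unfolding rect[OF T(1), symmetric] rp using cint by simp
    moreover have "contour_integral (linepath ?a ?b) f = J v T"
      unfolding J_def
      by (rule contour_integral_unique[OF has_contour_integral_linepath_same_Im[OF _ con(1)]])
         (use T in simp)
    moreover have "contour_integral (linepath ?d ?c) f = J w T"
      unfolding J_def
      by (rule contour_integral_unique[OF has_contour_integral_linepath_same_Im[OF _ con']])
         (use T in simp)
    moreover have "contour_integral (linepath ?c ?d) f = - contour_integral (linepath ?d ?c) f"
      by (rule contour_integral_reverse_linepath[OF con(3)])
    ultimately have "J v T - J w T - c = - contour_integral (linepath ?b ?c) f - contour_integral (linepath ?d ?a) f"
      by (simp add: algebra_simps)
    moreover have "norm (contour_integral (linepath ?b ?c) f) \<le> M * exp (- (\<eta> * T)) * norm (?c - ?b)"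
    proof (rule contour_integral_bound_linepath[OF cint(2)])
      fix t assume "t \<in> closed_segment ?b ?c"
      hence "Re t = T" "v \<le> Im t" "Im t \<le> w"
        using vw by (auto simp: closed_segment_same_Re closed_segment_eq_real_ivl)
      thus "norm (f t) \<le> M * exp (- (\<eta> * T))" using decay(2)[of t] T by simp
    qed (use M in auto)
    moreover have "norm (contour_integral (linepath ?d ?a) f) \<le> M * exp (- (\<eta> * T)) * norm (?a - ?d)"
    proof (rule contour_integral_bound_linepath[OF cint(4)])
      fix t assume "t \<in> closed_segment ?d ?a"
      hence "Re t = - T" "v \<le> Im t" "Im t \<le> w"
        using vw by (auto simp: closed_segment_same_Re closed_segment_eq_real_ivl)
      thus "norm (f t) \<le> M * exp (- (\<eta> * T))" using decay(2)[of t] T by simp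
    qed (use M in auto)
    moreover have "norm (?c - ?b) = w - v" "norm (?a - ?d) = w - v"
      using vw by (auto simp: cmod_def)
    ultimately show ?thesis
      using norm_triangle_ineq4[of "- contour_integral (linepath ?b ?c) f" "contour_integral (linepath ?d ?a) f"]
      by simp
  qed
  have "filterlim (\<lambda>n. - (\<eta> * real n)) at_bot sequentially"
    unfolding filterlim_uminus_at_bot minus_minus
    by (rule filterlim_tendsto_pos_mult_at_top[OF tendsto_const decay(1) filterlim_real_sequentially])
  hence "(\<lambda>n. exp (- (\<eta> * real n))) \<longlonglongrightarrow> 0"
    by (rule filterlim_compose[OF exp_at_bot])
  hence null: "(\<lambda>n. 2 * (M * exp (- (\<eta> * real n)) * (w - v))) \<longlonglongrightarrow> 2 * (M * 0 * (w - v))"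
    by (intro tendsto_mult tendsto_const)
  have le: "eventually (\<lambda>n. norm (J v (real n) - J w (real n) - c) \<le> 2 * (M * exp (- (\<eta> * real n)) * (w - v))) sequentially"
    using eventually_gt_at_top[of "nat \<lceil>max 0 R\<rceil>"]
  proof eventually_elim
    case (elim n)
    hence "max 0 R < real n" by linarith
    thus ?case by (intro bound) auto
  qed
  have "(\<lambda>n. J v (real n) - J w (real n) - c) \<longlonglongrightarrow> 0"
    by (rule Lim_null_comparison[OF le]) (use null in simp)
  moreover have "(\<lambda>n. J v (real n) - J w (real n) - c) \<longlonglongrightarrow>
      (LINT u|lborel. f (Complex u v)) - (LINT u|lborel. f (Complex u w)) - c"
    by (intro tendsto_diff tendsto_const J int)
  ultimately show ?thesis using LIMSEQ_unique by fastforce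
qed

section \<open>Integrals over the real line as sums of residues\<close>

text \<open>
  Lifting the line of integration by \<open>2 \<pi>\<close> crosses exactly one pole, and the lines
  \<open>Im t = \<epsilon> + 2 \<pi> q\<close> avoid all of them. The residues therefore telescope against the line
  integrals, which tend to \<open>0\<close> for \<open>q \<rightarrow> \<infinity>\<close> because \<open>e\<^bsup>m t\<^esup>\<close> decays upwards faster than
  \<open>G\<close> may grow. The sum of the residues does not depend on \<open>\<epsilon>\<close>, so it is also the limit of
  the line integrals for \<open>\<epsilon> \<rightarrow> 0\<close>.

  Growth of \<open>G\<close> is required above each line \<open>Im t = \<epsilon>\<close> only. Near the real line a dominating
  function \<open>B\<close> and convergence almost everywhere suffice, so that an integrable singularity of
  \<open>G\<close> on the real line does no harm.
\<close>

lemma line_integral_sums_residues: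
  fixes X :: "nat \<Rightarrow> complex \<Rightarrow> complex" and G :: "complex \<Rightarrow> complex" and B :: "real \<Rightarrow> real"
  assumes \<gamma>: "\<gamma> \<noteq> 0" "\<bar>Arg \<gamma>\<bar> < pi"
    and m: "0 < Re m" "Re m < 1" "0 < Im m"
    and X: "\<And>i t. 0 < Im t \<Longrightarrow> (X i has_field_derivative exp t * X (Suc i) t) (at t)"
    and X0: "\<And>t. exp t * X 0 t = exp (m * t) * G t"
    and growth: "\<And>\<epsilon> \<eta>. \<lbrakk>\<epsilon> > 0; \<eta> > 0\<rbrakk> \<Longrightarrow>
                   \<exists>M. \<forall>t. Im t \<ge> \<epsilon> \<longrightarrow> norm (G t) \<le> M * exp (\<eta> * (\<bar>Re t\<bar> + Im t))"
    and dom: "\<And>\<delta>. \<delta> > 0 \<Longrightarrow> integrable lborel (\<lambda>u. B u * exp (- (\<delta> * \<bar>u\<bar>)))"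
      "\<And>y. \<lbrakk>0 < y; y \<le> 1\<rbrakk> \<Longrightarrow> AE u in lborel. norm (G (Complex u y)) \<le> B u"
    and lim: "AE u in lborel. ((\<lambda>y. G (Complex u y)) \<longlongrightarrow> G (of_real u)) (at_right 0)"
    and meas: "(\<lambda>u. G (of_real u)) \<in> borel_measurable borel"
  shows "integrable lborel (\<lambda>u. exp (m * of_real u) * G (of_real u) / (exp (of_real u) + \<gamma>) ^ Suc j)"
      (is ?integrable)
    and "(\<lambda>q. 2 * pi * \<i> * X j (Ln \<gamma> + \<i> * pi + 2 * pi * \<i> * of_nat q) / fact j) sums
           (LINT u|lborel. exp (m * of_real u) * G (of_real u) / (exp (of_real u) + \<gamma>) ^ Suc j)"
      (is ?sums)
proof -
  define f where "f = (\<lambda>t. exp (m * t) * G t / (exp t + \<gamma>) ^ Suc j)"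
  define I where "I = (\<lambda>y. LINT u|lborel. f (Complex u y))"
  define r where "r = (\<lambda>q. 2 * pi * \<i> * X j (Ln \<gamma> + \<i> * pi + 2 * pi * \<i> * of_nat q) / fact j)"
  define \<delta> where "\<delta> = min (Re m) (1 - Re m)"
  \<comment> \<open>below this height the lines stay clear of the poles, whose imaginary parts are \<open>Arg \<gamma> + \<pi> + 2 \<pi> q\<close>\<close>
  define \<epsilon>0 where "\<epsilon>0 = min 1 ((pi - \<bar>Arg \<gamma>\<bar>) / 2)"
  have \<delta>: "\<delta> > 0" using m by (simp add: \<delta>_def)
  have \<epsilon>0: "0 < \<epsilon>0" "\<epsilon>0 \<le> 1" "\<epsilon>0 \<le> (pi - \<bar>Arg \<gamma>\<bar>) / 2"
  proof -
    show "0 < \<epsilon>0" using \<gamma> by (simp add: \<epsilon>0_def)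
  qed (unfold \<epsilon>0_def, rule min.cobounded1, rule min.cobounded2)
  obtain c where c: "0 < c" and c_lines:
    "\<And>t q. \<lbrakk>2 * pi * real q \<le> Im t; Im t \<le> (pi - \<bar>Arg \<gamma>\<bar>) / 2 + 2 * pi * real q\<rbrakk> \<Longrightarrow>
       c * (1 + exp (Re t)) \<le> norm (exp t + \<gamma>)"
    using exp_plus_lower_bound_on_lines[OF \<gamma>] by blast
  have f_alt: "f = (\<lambda>t. exp t * X 0 t / (exp t + \<gamma>) ^ Suc j)"
    unfolding f_def by (simp add: X0)
  have f_deriv_ex: "isCont f t" if "0 < Im t" "exp t + \<gamma> \<noteq> 0" for t
    unfolding f_alt using that by (intro continuous_intros DERIV_isCont[OF X]) auto
  have kernel: "norm (f t) \<le> exp (- (Im m * Im t)) * exp (- (\<delta> * \<bar>Re t\<bar>)) / d ^ Suc j * norm (G t)"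
    if "0 < d" "d * (1 + exp (Re t)) \<le> norm (exp t + \<gamma>)" for t d
  proof -
    have "norm (f t) = norm (exp (m * t) / (exp t + \<gamma>) ^ Suc j) * norm (G t)"
      by (simp add: f_def norm_mult norm_divide)
    also have "\<dots> \<le> exp (- (Im m * Im t)) * exp (- (\<delta> * \<bar>Re t\<bar>)) / d ^ Suc j * norm (G t)"
      unfolding \<delta>_def using that m by (intro mult_right_mono norm_exp_kernel_le) auto
    finally show ?thesis .
  qed
  \<comment> \<open>half of the available decay is kept, the other half pays for the growth of \<open>G\<close>\<close>
  define \<eta> where "\<eta> = min \<delta> (Im m) / 2"
  have \<eta>: "\<eta> > 0" "2 * \<eta> \<le> \<delta>" "2 * \<eta> \<le> Im m" using \<delta> m by (auto simp: \<eta>_def)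
  have decay: "\<exists>M\<ge>0. \<forall>t. Im t \<ge> \<epsilon> \<longrightarrow> d * (1 + exp (Re t)) \<le> norm (exp t + \<gamma>) \<longrightarrow>
      norm (f t) \<le> M * exp (- (\<eta> * Im t)) * exp (- (\<eta> * \<bar>Re t\<bar>))" if \<epsilon>: "\<epsilon> > 0" and d: "d > 0" for \<epsilon> d
  proof -
    obtain M where M: "\<And>t. Im t \<ge> \<epsilon> \<Longrightarrow> norm (G t) \<le> M * exp (\<eta> * (\<bar>Re t\<bar> + Im t))"
      using growth[OF \<epsilon> \<eta>(1)] by blast
    have "0 \<le> norm (G (Complex 0 \<epsilon>))" by simp
    also have "\<dots> \<le> M * exp (\<eta> * (\<bar>Re (Complex 0 \<epsilon>)\<bar> + Im (Complex 0 \<epsilon>)))" by (rule M) simp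
    finally have M0: "M \<ge> 0" by (simp add: zero_le_mult_iff)
    have "norm (f t) \<le> M / d ^ Suc j * exp (- (\<eta> * Im t)) * exp (- (\<eta> * \<bar>Re t\<bar>))"
      if t: "Im t \<ge> \<epsilon>" "d * (1 + exp (Re t)) \<le> norm (exp t + \<gamma>)" for t
    proof -
      have "norm (f t) \<le> exp (- (Im m * Im t)) * exp (- (\<delta> * \<bar>Re t\<bar>)) / d ^ Suc j * norm (G t)"
        by (rule kernel[OF d t(2)])
      also have "\<dots> \<le> exp (- (Im m * Im t)) * exp (- (\<delta> * \<bar>Re t\<bar>)) / d ^ Suc j
                        * (M * exp (\<eta> * (\<bar>Re t\<bar> + Im t)))"
        using d by (intro mult_left_mono M t) auto
      also have "\<dots> = M / d ^ Suc j * exp ((\<eta> - Im m) * Im t + (\<eta> - \<delta>) * \<bar>Re t\<bar>)"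
        by (simp add: algebra_simps exp_add exp_diff exp_minus divide_inverse)
      also have "\<dots> \<le> M / d ^ Suc j * exp ((- \<eta>) * Im t + (- \<eta>) * \<bar>Re t\<bar>)"
        using \<eta> t \<epsilon> M0 d unfolding exp_le_cancel_iff
        by (intro mult_left_mono iffD2[OF exp_le_cancel_iff] add_mono mult_right_mono) auto
      also have "\<dots> = M / d ^ Suc j * exp (- (\<eta> * Im t)) * exp (- (\<eta> * \<bar>Re t\<bar>))"
        by (simp add: exp_add exp_minus exp_diff divide_inverse)
      finally show ?thesis .
    qed
    moreover have "M / d ^ Suc j \<ge> 0" using M0 d by simp
    ultimately show ?thesis by blast
  qed
  have on_line: "c * (1 + exp (Re t)) \<le> norm (exp t + \<gamma>)"
    if "0 < \<epsilon>" "\<epsilon> \<le> \<epsilon>0" "Im t = \<epsilon> + 2 * pi * real q" for t \<epsilon> q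
    using that \<epsilon>0 by (intro c_lines[of q]) auto
  have nz: "exp t + \<gamma> \<noteq> 0" if "0 < \<epsilon>" "\<epsilon> \<le> \<epsilon>0" "Im t = \<epsilon> + 2 * pi * real q" for t \<epsilon> q
  proof -
    have "0 < c * (1 + exp (Re t))" using c by (intro mult_pos_pos add_pos_pos) auto
    thus ?thesis using on_line[OF that] by auto
  qed
  have f_meas: "(\<lambda>u. f (Complex u (\<epsilon> + 2 * pi * real q))) \<in> borel_measurable borel"
    if "0 < \<epsilon>" "\<epsilon> \<le> \<epsilon>0" for \<epsilon> q
  proof (intro borel_measurable_continuous_onI continuous_at_imp_continuous_on ballI)
    fix u :: real
    have "isCont f (Complex u (\<epsilon> + 2 * pi * real q))"
      using that nz[OF that, of "Complex u (\<epsilon> + 2 * pi * real q)" q]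
      by (intro f_deriv_ex) (auto intro: add_pos_nonneg)
    moreover have "isCont (\<lambda>u. Complex u (\<epsilon> + 2 * pi * real q)) u"
      unfolding Complex_eq by (intro continuous_intros)
    ultimately show "isCont (\<lambda>u. f (Complex u (\<epsilon> + 2 * pi * real q))) u"
      using isCont_o2 by blast
  qed
  have line: "\<exists>M\<ge>0. \<forall>q u. norm (f (Complex u (\<epsilon> + 2 * pi * real q)))
                \<le> M * exp (- (\<eta> * (\<epsilon> + 2 * pi * real q))) * exp (- (\<eta> * \<bar>u\<bar>))"
    if \<epsilon>: "0 < \<epsilon>" "\<epsilon> \<le> \<epsilon>0" for \<epsilon>
  proof -
    obtain M where "M \<ge> 0" and M: "\<And>t. \<lbrakk>Im t \<ge> \<epsilon>; c * (1 + exp (Re t)) \<le> norm (exp t + \<gamma>)\<rbrakk> \<Longrightarrow>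
      norm (f t) \<le> M * exp (- (\<eta> * Im t)) * exp (- (\<eta> * \<bar>Re t\<bar>))"
      using decay[OF \<epsilon>(1) c] by blast
    have "norm (f (Complex u (\<epsilon> + 2 * pi * real q)))
                \<le> M * exp (- (\<eta> * (\<epsilon> + 2 * pi * real q))) * exp (- (\<eta> * \<bar>u\<bar>))" for q u
      using M[of "Complex u (\<epsilon> + 2 * pi * real q)"] on_line[OF \<epsilon>, of "Complex u (\<epsilon> + 2 * pi * real q)" q] \<epsilon>
      by simp
    with \<open>M \<ge> 0\<close> show ?thesis by blast
  qed
  have f_int: "integrable lborel (\<lambda>u. f (Complex u (\<epsilon> + 2 * pi * real q)))"
    if \<epsilon>: "0 < \<epsilon>" "\<epsilon> \<le> \<epsilon>0" for \<epsilon> q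
  proof -
    obtain M where M: "M \<ge> 0" "\<And>q u. norm (f (Complex u (\<epsilon> + 2 * pi * real q)))
                \<le> M * exp (- (\<eta> * (\<epsilon> + 2 * pi * real q))) * exp (- (\<eta> * \<bar>u\<bar>))"
      using line[OF \<epsilon>] by blast
    show ?thesis
    proof (rule Bochner_Integration.integrable_bound)
      show "integrable lborel (\<lambda>u. M * exp (- (\<eta> * (\<epsilon> + 2 * pi * real q))) * exp (- (\<eta> * \<bar>u\<bar>)))"
        by (intro integrable_mult_right integrable_exp_neg_abs \<eta>)
      show "AE u in lborel. norm (f (Complex u (\<epsilon> + 2 * pi * real q)))
          \<le> norm (M * exp (- (\<eta> * (\<epsilon> + 2 * pi * real q))) * exp (- (\<eta> * \<bar>u\<bar>)))"
        using M by (auto simp: abs_mult)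
    qed (use f_meas[OF \<epsilon>] in simp)
  qed
  have strip: "I (\<epsilon> + 2 * pi * real q) - I (\<epsilon> + 2 * pi * real (Suc q)) = r q"
    if \<epsilon>: "0 < \<epsilon>" "\<epsilon> \<le> \<epsilon>0" for \<epsilon> q
  proof -
    define v where "v = \<epsilon> + 2 * pi * real q"
    define w where "w = \<epsilon> + 2 * pi * real (Suc q)"
    have w: "w = v + 2 * pi" by (simp add: v_def w_def algebra_simps)
    have v: "v > 0" using \<epsilon> by (auto simp: v_def intro: add_pos_nonneg)
    define t0 where "t0 = Ln \<gamma> + \<i> * pi + 2 * pi * \<i> * of_nat q"
    have Imt0: "Im t0 = Arg \<gamma> + pi + 2 * pi * real q"
      using \<gamma> by (simp add: t0_def Arg_eq_Im_Ln)
    have Ret0: "Re t0 = ln (norm \<gamma>)" using \<gamma> by (simp add: t0_def)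
    have bd: "v < Im t0" "Im t0 < w"
      using \<epsilon> \<epsilon>0 \<gamma> by (auto simp: v_def Imt0 w)
    have "exp t0 = exp (Ln \<gamma>) * exp (\<i> * pi) * exp (2 * pi * \<i> * of_nat q)"
      unfolding t0_def exp_add ..
    also have "exp (2 * pi * \<i> * of_nat q) = 1"
      using exp_of_nat_mult[of q "2 * pi * \<i>"] by (simp add: mult_ac)
    finally have et0: "exp t0 = - \<gamma>" using \<gamma> by simp
    \<comment> \<open>the strip between the neighbouring poles, cut off at the real line\<close>
    define S where "S = {t. 0 < Im t} \<inter> {t. Im t0 - 2 * pi < Im t} \<inter> {t. Im t < Im t0 + 2 * pi}"
    have S: "open S" "convex S" "t0 \<in> S"
      unfolding S_def
      by (intro open_Int open_halfspace_Im_gt open_halfspace_Im_lt)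
         (intro convex_Int convex_halfspace_Im_gt convex_halfspace_Im_lt, use v bd in simp)
    have pole: "exp t + \<gamma> = 0 \<longleftrightarrow> t = t0" if "t \<in> S" for t
    proof
      assume "exp t + \<gamma> = 0"
      hence "exp t = exp t0" using et0 by (metis eq_neg_iff_add_eq_0)
      then obtain n :: int where n: "t = t0 + of_int (2 * n) * pi * \<i>" by (auto simp: exp_eq)
      hence "Im t = Im t0 + 2 * pi * of_int n" by simp
      with that have "2 * pi * real_of_int n < 2 * pi * 1" "2 * pi * (- 1) < 2 * pi * real_of_int n"
        by (simp_all add: S_def)
      hence "real_of_int n < 1" "- 1 < real_of_int n"
        by (simp_all only: mult_less_cancel_left_pos[of "2 * pi"] pi_gt_zero zero_less_mult_iff zero_less_numeral simp_thms)
      hence "n = 0" by linarith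
      thus "t = t0" using n by simp
    qed (use et0 in simp)
    define T0 where "T0 = ln 2 + \<bar>ln (norm \<gamma>)\<bar>"
    define d where "d = min 1 (norm \<gamma>) / 4"
    have d: "d > 0" using \<gamma> by (simp add: d_def)
    obtain M where "M \<ge> 0" and M: "\<And>t. \<lbrakk>Im t \<ge> \<epsilon>; d * (1 + exp (Re t)) \<le> norm (exp t + \<gamma>)\<rbrakk> \<Longrightarrow>
        norm (f t) \<le> M * exp (- (\<eta> * Im t)) * exp (- (\<eta> * \<bar>Re t\<bar>))"
      using decay[OF \<epsilon>(1) d] by blast
    have path: "path_image (rectpath (Complex (-T) v) (Complex T w)) \<subseteq> S - {t0}"
      and t0box: "t0 \<in> box (Complex (-T) v) (Complex T w)"
      and cboxS: "cbox (Complex (-T) v) (Complex T w) \<subseteq> S"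
      and T0: "T > 0" if "T > T0" for T
    proof -
      have T: "T > \<bar>Re t0\<bar>" using that unfolding Ret0 T0_def
        using ln_gt_zero[of "2::real"] by linarith
      thus T0: "T > 0" by linarith
      show t0box: "t0 \<in> box (Complex (-T) v) (Complex T w)"
        using T bd by (auto simp: in_box_complex_iff)
      show cboxS: "cbox (Complex (-T) v) (Complex T w) \<subseteq> S"
        using v bd w by (auto simp: in_cbox_complex_iff S_def)
      show "path_image (rectpath (Complex (-T) v) (Complex T w)) \<subseteq> S - {t0}"
        using path_image_rectpath_cbox_minus_box[of "Complex (-T) v" "Complex T w"] t0box cboxS T0 w
        by auto
    qed
    have "I v - I w = r q"
      unfolding I_def
    proof (rule horizontal_line_integrals_differ_by_residue[where R = T0 and \<eta> = \<eta> and M = M])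
      show "v < w" using w by simp
      fix T assume T: "T > T0"
      show "continuous_on (path_image (rectpath (Complex (-T) v) (Complex T w))) f"
      proof (intro continuous_at_imp_continuous_on ballI f_deriv_ex)
        fix t assume "t \<in> path_image (rectpath (Complex (-T) v) (Complex T w))"
        hence "t \<in> S - {t0}" using path[OF T] by blast
        thus "0 < Im t" "exp t + \<gamma> \<noteq> 0" using pole[of t] by (auto simp: S_def)
      qed
      have "(f has_contour_integral 2 * pi * \<i> * X j t0 / fact j)
              (rectpath (Complex (-T) v) (Complex T w))"
        unfolding f_alt
      proof (rule has_contour_integral_exp_pole[where S = S])
        show "(X i has_field_derivative exp t * X (Suc i) t) (at t)" if "t \<in> S" for i t
          using that by (intro X) (auto simp: S_def)
        show "winding_number (rectpath (Complex (-T) v) (Complex T w)) z = 0" if "z \<notin> S" for z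
          using that cboxS[OF T] T0[OF T] w by (intro winding_number_rectpath_outside) auto
        show "winding_number (rectpath (Complex (-T) v) (Complex T w)) t0 = 1"
          by (intro winding_number_rectpath t0box T)
      qed (use S pole path[OF T] in \<open>auto simp: convex_connected\<close>)
      thus "contour_integral (rectpath (Complex (-T) v) (Complex T w)) f = r q"
        unfolding r_def t0_def by (rule contour_integral_unique)
    next
      fix t assume t: "\<bar>Re t\<bar> > T0" "v \<le> Im t" "Im t \<le> w"
      have "Im t \<ge> \<epsilon>" using t by (auto simp: v_def intro: order_trans[rotated])
      have "norm (f t) \<le> M * exp (- (\<eta> * Im t)) * exp (- (\<eta> * \<bar>Re t\<bar>))"
        using t \<open>Im t \<ge> \<epsilon>\<close> exp_plus_lower_bound_far_out[OF \<gamma>(1), of t]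
        by (intro M) (simp_all add: d_def T0_def)
      also have "\<dots> \<le> M * 1 * exp (- (\<eta> * \<bar>Re t\<bar>))"
        using \<open>M \<ge> 0\<close> \<eta> \<epsilon> \<open>Im t \<ge> \<epsilon>\<close> by (intro mult_right_mono mult_left_mono) auto
      finally show "norm (f t) \<le> M * exp (- (\<eta> * \<bar>Re t\<bar>))" by simp
    qed (use \<eta> f_int[OF \<epsilon>] in \<open>auto simp: v_def w_def simp del: of_nat_Suc\<close>)
    thus ?thesis by (simp add: v_def w_def)
  qed
  have sums_line: "r sums I \<epsilon>" if \<epsilon>: "0 < \<epsilon>" "\<epsilon> \<le> \<epsilon>0" for \<epsilon>
  proof -
    obtain M where M: "M \<ge> 0" "\<And>q u. norm (f (Complex u (\<epsilon> + 2 * pi * real q)))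
                \<le> M * exp (- (\<eta> * (\<epsilon> + 2 * pi * real q))) * exp (- (\<eta> * \<bar>u\<bar>))"
      using line[OF \<epsilon>] by blast
    define A where "A = (LINT u|lborel. exp (- (\<eta> * \<bar>u\<bar>)))"
    have le: "norm (I (\<epsilon> + 2 * pi * real q)) \<le> M * exp (- (\<eta> * (\<epsilon> + 2 * pi * real q))) * A" for q
    proof -
      have "norm (I (\<epsilon> + 2 * pi * real q))
          \<le> (LINT u|lborel. M * exp (- (\<eta> * (\<epsilon> + 2 * pi * real q))) * exp (- (\<eta> * \<bar>u\<bar>)))"
        unfolding I_def
        by (rule Bochner_Integration.integral_norm_bound_integral)
           (use M f_int[OF \<epsilon>] \<eta> in \<open>auto intro!: integrable_exp_neg_abs\<close>)
      thus ?thesis by (simp add: A_def)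
    qed
    have null: "(\<lambda>q. M * exp (- (\<eta> * (\<epsilon> + 2 * pi * real q))) * A) \<longlonglongrightarrow> M * 0 * A"
    proof -
      have "filterlim (\<lambda>q. (2 * pi) * real q) at_top sequentially"
        by (rule filterlim_tendsto_pos_mult_at_top[OF tendsto_const _ filterlim_real_sequentially]) simp
      hence "filterlim (\<lambda>q. \<epsilon> + (2 * pi) * real q) at_top sequentially"
        by (rule filterlim_tendsto_add_at_top[OF tendsto_const])
      hence "filterlim (\<lambda>q. - (\<eta> * (\<epsilon> + 2 * pi * real q))) at_bot sequentially"
        unfolding filterlim_uminus_at_bot minus_minus
        by (rule filterlim_tendsto_pos_mult_at_top[OF tendsto_const \<eta>(1)])
      hence "(\<lambda>q. exp (- (\<eta> * (\<epsilon> + 2 * pi * real q)))) \<longlonglongrightarrow> 0"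
        by (rule filterlim_compose[OF exp_at_bot])
      thus ?thesis by (intro tendsto_mult tendsto_const)
    qed
    have "(\<lambda>q. I (\<epsilon> + 2 * pi * real q)) \<longlonglongrightarrow> 0"
      by (rule Lim_null_comparison[OF always_eventually[OF allI[OF le]]]) (use null in simp)
    from telescope_sums'[OF this] show ?thesis by (simp only: strip[OF \<epsilon>]) simp
  qed
  define \<epsilon> where "\<epsilon> = (\<lambda>N. \<epsilon>0 / real (Suc N))"
  have \<epsilon>: "0 < \<epsilon> N" "\<epsilon> N \<le> \<epsilon>0" for N
    using \<epsilon>0 by (auto simp: \<epsilon>_def divide_simps simp del: of_nat_Suc) (simp add: algebra_simps)?
  have "\<epsilon> \<longlonglongrightarrow> 0" unfolding \<epsilon>_def by (rule LIMSEQ_Suc[OF lim_const_over_n])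
  hence \<epsilon>_lim: "filterlim \<epsilon> (at_right 0) sequentially"
    unfolding filterlim_at using \<epsilon>(1) by (auto intro!: always_eventually simp: less_imp_neq[THEN not_sym])
  have meas_real: "(\<lambda>u. f (of_real u)) \<in> borel_measurable lborel"
    unfolding f_def using meas by measurable
  have limf: "AE u in lborel. (\<lambda>N. f (Complex u (\<epsilon> N))) \<longlonglongrightarrow> f (of_real u)"
    using lim
  proof eventually_elim
    case (elim u)
    have cpx: "((\<lambda>y. Complex u y) \<longlongrightarrow> of_real u) (at_right 0)"
      unfolding Complex_eq by (auto intro!: tendsto_eq_intros)
    have "0 < c * (1 + exp u)" using c by (intro mult_pos_pos add_pos_pos) auto
    hence "exp (complex_of_real u) + \<gamma> \<noteq> 0"
      using c_lines[of 0 "of_real u"] \<gamma> by auto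
    hence "((\<lambda>y. f (Complex u y)) \<longlongrightarrow> f (of_real u)) (at_right 0)"
      unfolding f_def by (intro tendsto_intros elim cpx) auto
    thus ?case by (rule filterlim_compose[OF _ \<epsilon>_lim])
  qed
  have bound: "AE u in lborel. norm (f (Complex u (\<epsilon> N))) \<le> B u * exp (- (\<delta> * \<bar>u\<bar>)) / c ^ Suc j" for N
    using dom(2)[OF \<epsilon>(1) order_trans[OF \<epsilon>(2) \<epsilon>0(2)], of N]
  proof eventually_elim
    case (elim u)
    have "norm (f (Complex u (\<epsilon> N))) \<le> exp (- (Im m * \<epsilon> N)) * exp (- (\<delta> * \<bar>u\<bar>)) / c ^ Suc j * norm (G (Complex u (\<epsilon> N)))"
      using kernel[OF c on_line[OF \<epsilon>, of "Complex u (\<epsilon> N)" N 0]] by simp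
    also have "\<dots> \<le> 1 * exp (- (\<delta> * \<bar>u\<bar>)) / c ^ Suc j * B u"
      using elim c m \<epsilon>[of N] by (intro mult_mono divide_right_mono) auto
    finally show ?case by (simp add: mult_ac)
  qed
  have wint: "integrable lborel (\<lambda>u. B u * exp (- (\<delta> * \<bar>u\<bar>)) / c ^ Suc j)"
    by (intro integrable_divide dom \<delta>)
  have mN: "(\<lambda>u. f (Complex u (\<epsilon> N))) \<in> borel_measurable lborel" for N
    using f_meas[OF \<epsilon>, of N 0] by simp
  note dct = meas_real mN wint limf bound
  show ?integrable
    using integrable_dominated_convergence[OF dct] by (simp only: f_def)
  have "(\<lambda>N. I (\<epsilon> N)) \<longlonglongrightarrow> (LINT u|lborel. f (of_real u))"
    unfolding I_def by (rule integral_dominated_convergence[OF dct])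
  moreover have "I (\<epsilon> N) = suminf r" for N using sums_line[OF \<epsilon>] by (rule sums_unique)
  ultimately have "suminf r = (LINT u|lborel. f (of_real u))"
    by (simp add: LIMSEQ_const_iff)
  hence "r sums (LINT u|lborel. f (of_real u))"
    using sums_line[OF \<epsilon>, of 0] by (simp add: sums_iff)
  thus ?sums by (simp only: r_def f_def)
qed

section \<open>Iterated derivatives in the exponential variable\<close>

lemma signed_stirling1_0 [simp]: "signed_stirling1 0 0 = 1"
  by (simp add: signed_stirling1_def)

lemma signed_stirling1_eq_0:
  assumes "j < p"
  shows "signed_stirling1 j p = 0"
proof -
  have "degree (\<Prod>i<j. [:- int i, 1:]) = j"
    by (subst degree_prod_eq_sum_degree) auto
  thus ?thesis using assms by (simp add: signed_stirling1_def coeff_eq_0)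
qed

lemma signed_stirling1_Suc_0: "signed_stirling1 (Suc j) 0 = - int j * signed_stirling1 j 0"
  by (simp add: signed_stirling1_def mult.commute[of "prod _ _"])

lemma signed_stirling1_Suc_Suc:
  "signed_stirling1 (Suc j) (Suc p) = signed_stirling1 j p - int j * signed_stirling1 j (Suc p)"
  by (simp add: signed_stirling1_def mult.commute[of "prod _ _"])

text \<open>
  Read with \<open>f p\<close> as \<open>y\<^sup>p\<close>, this multiplies a falling factorial by its next factor
  \<open>y - j\<close>. Below \<open>f p\<close> is a \<open>p\<close>-th derivative.
\<close>

lemma sum_signed_stirling1_Suc:
  fixes f :: "nat \<Rightarrow> complex"
  shows "(\<Sum>p\<le>Suc j. of_int (signed_stirling1 (Suc j) p) * f p)
       = (\<Sum>p\<le>j. of_int (signed_stirling1 j p) * f (Suc p))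
         - of_nat j * (\<Sum>p\<le>j. of_int (signed_stirling1 j p) * f p)"
proof -
  have "(\<Sum>p\<le>j. of_int (signed_stirling1 j p) * f p)
      = (\<Sum>p\<le>Suc j. of_int (signed_stirling1 j p) * f p)"
    by (simp add: signed_stirling1_eq_0)
  also have "\<dots> = of_int (signed_stirling1 j 0) * f 0
                  + (\<Sum>p\<le>j. of_int (signed_stirling1 j (Suc p)) * f (Suc p))"
    by (rule sum.atMost_Suc_shift)
  finally have "of_nat j * (\<Sum>p\<le>j. of_int (signed_stirling1 j p) * f p)
      = of_nat j * (of_int (signed_stirling1 j 0) * f 0)
        + (\<Sum>p\<le>j. of_nat j * (of_int (signed_stirling1 j (Suc p)) * f (Suc p)))"
    by (simp only: ring_distribs sum_distrib_left)
  thus ?thesis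
    by (simp add: sum.atMost_Suc_shift signed_stirling1_Suc_0 signed_stirling1_Suc_Suc
          ring_distribs sum_subtractf mult.assoc del: sum.atMost_Suc)
qed

text \<open>
  Pascal's rule, as it appears in one more application of the Leibniz rule to a product with
  \<open>e\<^bsup>c t\<^esup>\<close>.
\<close>

lemma sum_binomial_Suc:
  fixes c :: "'a :: comm_ring_1"
  shows "(\<Sum>h\<le>Suc p. of_nat (Suc p choose h) * c ^ (Suc p - h) * g h)
       = c * (\<Sum>h\<le>p. of_nat (p choose h) * c ^ (p - h) * g h)
         + (\<Sum>h\<le>p. of_nat (p choose h) * c ^ (p - h) * g (Suc h))"
proof -
  have "c * (\<Sum>h\<le>p. of_nat (p choose h) * c ^ (p - h) * g h)
      = (\<Sum>h\<le>Suc p. of_nat (p choose h) * c ^ (Suc p - h) * g h)"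
    by (simp add: sum_distrib_left Suc_diff_le mult_ac binomial_eq_0)
  also have "\<dots> = c ^ Suc p * g 0 + (\<Sum>h\<le>p. of_nat (p choose Suc h) * c ^ (p - h) * g (Suc h))"
    by (subst sum.atMost_Suc_shift) simp
  finally show ?thesis
    by (subst sum.atMost_Suc_shift) (simp add: ring_distribs sum.distrib)
qed

text \<open>
  If each \<open>g (Suc h)\<close> is the derivative of \<open>g h\<close>, this is the \<open>p\<close>-th derivative of
  \<open>e\<^bsup>c t\<^esup> g 0 t\<close>, written out by the Leibniz rule.
\<close>

definition exp_product_deriv ::
    "complex \<Rightarrow> (nat \<Rightarrow> complex \<Rightarrow> complex) \<Rightarrow> nat \<Rightarrow> complex \<Rightarrow> complex" where
  "exp_product_deriv c g p t = exp (c * t) * (\<Sum>h\<le>p. of_nat (p choose h) * c ^ (p - h) * g h t)"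

lemma has_field_derivative_exp_product_deriv:
  assumes "\<And>h. (g h has_field_derivative g (Suc h) t) (at t)"
  shows "(exp_product_deriv c g p has_field_derivative exp_product_deriv c g (Suc p) t) (at t)"
proof -
  define S where "S = (\<lambda>(g :: nat \<Rightarrow> complex \<Rightarrow> complex) t. \<Sum>h\<le>p. of_nat (p choose h) * c ^ (p - h) * g h t)"
  have "(S g has_field_derivative S (\<lambda>h. g (Suc h)) t) (at t)"
    unfolding S_def by (auto intro!: derivative_eq_intros assms simp: mult_ac)
  hence "((\<lambda>t. exp (c * t) * S g t) has_field_derivative
           exp (c * t) * (c * S g t + S (\<lambda>h. g (Suc h)) t)) (at t)"
    by (auto intro!: derivative_eq_intros simp: algebra_simps)
  thus ?thesis
    unfolding exp_product_deriv_def[abs_def] S_def sum_binomial_Suc .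
qed

text \<open>
  For the same families \<open>g\<close>, the \<open>j\<close>-th derivative of \<open>e\<^bsup>c t\<^esup> g 0 t\<close> with respect to \<open>x = e\<^sup>t\<close>, as
  \<open>e\<^bsup>-j t\<^esup> D (D - 1) \<cdots> (D - j + 1)\<close> with \<open>D = d/dt\<close>.
\<close>

definition falling_exp_deriv ::
    "complex \<Rightarrow> (nat \<Rightarrow> complex \<Rightarrow> complex) \<Rightarrow> nat \<Rightarrow> complex \<Rightarrow> complex" where
  "falling_exp_deriv c g j t =
     exp (- of_nat j * t) * (\<Sum>p\<le>j. of_int (signed_stirling1 j p) * exp_product_deriv c g p t)"

lemma has_field_derivative_falling_exp_deriv:
  assumes "\<And>h. (g h has_field_derivative g (Suc h) t) (at t)"
  shows "(falling_exp_deriv c g j has_field_derivative exp t * falling_exp_deriv c g (Suc j) t) (at t)"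
proof -
  let ?W = "exp_product_deriv c g"
  define S where "S = (\<lambda>(W :: nat \<Rightarrow> complex \<Rightarrow> complex) t. \<Sum>p\<le>j. of_int (signed_stirling1 j p) * W p t)"
  have "(S ?W has_field_derivative S (\<lambda>p. ?W (Suc p)) t) (at t)"
    unfolding S_def
    by (auto intro!: derivative_eq_intros has_field_derivative_exp_product_deriv assms simp: mult_ac)
  hence "((\<lambda>t. exp (- of_nat j * t) * S ?W t) has_field_derivative
           exp (- of_nat j * t) * (S (\<lambda>p. ?W (Suc p)) t - of_nat j * S ?W t)) (at t)"
    by (auto intro!: derivative_eq_intros simp: algebra_simps)
  moreover have "exp (- of_nat j * t) = exp t * exp (- of_nat (Suc j) * t)"
    by (simp add: algebra_simps flip: exp_add)
  ultimately show ?thesis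
    unfolding falling_exp_deriv_def[abs_def] S_def sum_signed_stirling1_Suc
    by (simp only: mult.assoc)
qed

text \<open>
  Expand \<open>(m - 1)\<^bsup>p - h\<^esup>\<close> by the binomial theorem and exchange the order of summation; both
  products of binomial coefficients count the ways to choose disjoint sets of sizes \<open>l\<close> and
  \<open>h\<close> among \<open>p\<close> elements.
\<close>

lemma sum_binomial_shift_by_minus_one:
  fixes m :: "'a :: comm_ring_1"
  shows "(\<Sum>h\<le>p. of_nat (p choose h) * (m - 1) ^ (p - h) * g h)
       = (\<Sum>l\<le>p. \<Sum>h\<le>p - l. of_nat (p choose l) * of_nat ((p - l) choose h)
             * (- 1) ^ l * m ^ (p - l - h) * g h)"
proof -
  have "(\<Sum>l\<le>p. \<Sum>h\<le>p - l. of_nat (p choose l) * of_nat ((p - l) choose h)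
             * (- 1) ^ l * m ^ (p - l - h) * g h)
      = (\<Sum>l\<in>{..p}. \<Sum>h\<in>{h\<in>{..p}. l + h \<le> p}. of_nat (p choose l) * of_nat ((p - l) choose h)
             * (- 1) ^ l * m ^ (p - l - h) * g h)"
    by (intro sum.cong refl) auto
  also have "\<dots> = (\<Sum>h\<in>{..p}. \<Sum>l\<in>{l\<in>{..p}. l + h \<le> p}. of_nat (p choose l) * of_nat ((p - l) choose h)
             * (- 1) ^ l * m ^ (p - l - h) * g h)"
    by (rule sum.swap_restrict) auto
  also have "\<dots> = (\<Sum>h\<in>{..p}. \<Sum>l\<in>{..p - h}. of_nat (p choose h) * g h
             * (of_nat ((p - h) choose l) * (- 1) ^ l * m ^ (p - h - l)))"
  proof (intro sum.cong refl)
    fix h l assume h: "h \<in> {..p}" and l: "l \<in> {..p - h}"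
    have "(p choose (p - h)) * ((p - h) choose l) = (p choose l) * ((p - l) choose (p - h - l))"
      using l by (intro choose_mult) auto
    moreover have "p choose (p - h) = p choose h" using h by (simp add: binomial_symmetric[symmetric])
    moreover have "(p - l) choose (p - h - l) = (p - l) choose h"
      using h l binomial_symmetric[of h "p - l"] by (simp add: diff_diff_left add.commute[of l h])
    ultimately have "of_nat (p choose l) * of_nat ((p - l) choose h)
        = (of_nat (p choose h) * of_nat ((p - h) choose l) :: 'a)"
      by (metis of_nat_mult)
    thus "of_nat (p choose l) * of_nat ((p - l) choose h) * (- 1) ^ l * m ^ (p - l - h) * g h
        = of_nat (p choose h) * g h * (of_nat ((p - h) choose l) * (- 1) ^ l * m ^ (p - h - l))"
      by (simp add: mult_ac diff_diff_left add.commute[of l h])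
  qed auto
  also have "\<dots> = (\<Sum>h\<in>{..p}. of_nat (p choose h) * g h * (- 1 + m) ^ (p - h))"
    by (simp only: binomial_ring sum_distrib_left mult.assoc)
  finally show ?thesis by (simp add: mult.assoc mult.commute[of _ "g _"] add.commute[of "- 1"])
qed

section \<open>Complex powers and integrable majorants\<close>

lemma norm_powr_le:
  fixes w s :: complex
  shows "norm (w powr s) \<le> norm w powr Re s * exp (pi * \<bar>Im s\<bar>)"
proof -
  have "- Im s * Arg w \<le> \<bar>Im s\<bar> * \<bar>Arg w\<bar>"
    by (metis abs_ge_self abs_minus abs_mult)
  also have "\<dots> \<le> \<bar>Im s\<bar> * pi"
    using Arg_bounded[of w] by (intro mult_left_mono) auto
  finally show ?thesis
    by (simp add: norm_powr_complex mult.commute mult_left_mono)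
qed

text \<open>
  The right-hand side is holomorphic across the real line except at \<open>0\<close>; on the closed upper
  half-plane it replaces the principal logarithm, whose own cut lies on the boundary.
\<close>

lemma Ln_eq_Ln_rotated:
  assumes "0 \<le> Im w" "w \<noteq> 0"
  shows "Ln w = Ln (- \<i> * w) + \<i> * pi / 2"
proof -
  have "\<i> * (- \<i> * w) = w" by simp
  moreover have "- \<i> * w \<noteq> 0" using assms by simp
  ultimately show ?thesis using Ln_times_ii[of "- \<i> * w"] assms by simp
qed

lemma rotated_not_in_nonpos_Reals:
  assumes "0 \<le> Im w" "w \<noteq> 0"
  shows "- \<i> * w \<notin> \<real>\<^sub>\<le>\<^sub>0"
  using assms by (auto simp: complex_nonpos_Reals_iff complex_eq_iff)

text \<open>
  The Pochhammer symbol with this argument is the falling factorial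
  \<open>k (k - 1) \<cdots> (k - h + 1)\<close>.
\<close>

lemma pochhammer_falling_Suc:
  fixes k :: "'a :: comm_ring_1"
  shows "pochhammer (1 - of_nat (Suc h) + k) (Suc h) = pochhammer (1 - of_nat h + k) h * (k - of_nat h)"
  by (simp add: pochhammer_rec algebra_simps)

lemma integrable_powr_mult_exp_neg_abs:
  fixes C s \<delta> :: real
  assumes "C > 0" "\<delta> > 0"
  shows "integrable lborel (\<lambda>u. (\<bar>u\<bar> + C) powr s * exp (- (\<delta> * \<bar>u\<bar>)))"
proof -
  obtain M where M: "M > 0" "\<And>x. x \<ge> C \<Longrightarrow> x powr s \<le> M * exp (\<delta> / 2 * x)"
    using powr_le_exp[of "\<delta> / 2" C s] assms by auto
  show ?thesis
  proof (rule Bochner_Integration.integrable_bound)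
    show "integrable lborel (\<lambda>u. M * exp (\<delta> / 2 * C) * exp (- (\<delta> / 2 * \<bar>u\<bar>)))"
      using assms by (intro integrable_mult_right integrable_exp_neg_abs) auto
    show "AE u in lborel. norm ((\<bar>u\<bar> + C) powr s * exp (- (\<delta> * \<bar>u\<bar>)))
            \<le> norm (M * exp (\<delta> / 2 * C) * exp (- (\<delta> / 2 * \<bar>u\<bar>)))"
    proof (rule AE_I2)
      fix u :: real
      have "(\<bar>u\<bar> + C) powr s * exp (- (\<delta> * \<bar>u\<bar>)) \<le> M * exp (\<delta> / 2 * (\<bar>u\<bar> + C)) * exp (- (\<delta> * \<bar>u\<bar>))"
        by (intro mult_right_mono M) auto
      also have "\<dots> = M * exp (\<delta> / 2 * C) * exp (- (\<delta> / 2 * \<bar>u\<bar>))"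
        by (simp add: mult.assoc flip: exp_add) (simp add: field_simps)
      finally show "norm ((\<bar>u\<bar> + C) powr s * exp (- (\<delta> * \<bar>u\<bar>)))
            \<le> norm (M * exp (\<delta> / 2 * C) * exp (- (\<delta> / 2 * \<bar>u\<bar>)))"
        using M(1) by (simp add: abs_mult)
    qed
  qed measurable
qed

text \<open>
  The power is integrable on both sides of its singularity and at most \<open>1\<close> at distance more
  than \<open>1\<close> from it.
\<close>

lemma integrable_abs_powr_mult_exp_neg_abs:
  fixes c s \<delta> :: real
  assumes "-1 < s" "s < 0" "\<delta> > 0"
  shows "integrable lborel (\<lambda>u. \<bar>u + c\<bar> powr s * exp (- (\<delta> * \<bar>u\<bar>)))"
proof -
  have "(\<lambda>x. x powr s) absolutely_integrable_on {0..1}"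
    using assms by (intro nonnegative_absolutely_integrable_1 integrable_on_powr_from_0) auto
  hence "integrable lebesgue (\<lambda>x. indicat_real {0..1} x * x powr s)"
    by (simp add: set_integrable_def)
  hence p: "integrable lborel (\<lambda>x. indicat_real {0..1} x * x powr s)"
    by (subst (asm) integrable_completion) auto
  have "integrable lborel (\<lambda>x. indicat_real {0..1} (c + 1 * x) * (c + 1 * x) powr s)"
    "integrable lborel (\<lambda>x. indicat_real {0..1} (- c + (-1) * x) * (- c + (-1) * x) powr s)"
    by (rule lborel_integrable_real_affine[OF p], simp)+
  from Bochner_Integration.integrable_add[OF Bochner_Integration.integrable_add[OF this] integrable_exp_neg_abs[OF assms(3)]]
  have int: "integrable lborel (\<lambda>x. indicat_real {0..1} (c + 1 * x) * (c + 1 * x) powr s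
       + indicat_real {0..1} (- c + (-1) * x) * (- c + (-1) * x) powr s + exp (- (\<delta> * \<bar>x\<bar>)))" .
  show ?thesis
  proof (rule Bochner_Integration.integrable_bound[OF int])
    show "AE u in lborel. norm (\<bar>u + c\<bar> powr s * exp (- (\<delta> * \<bar>u\<bar>)))
       \<le> norm (indicat_real {0..1} (c + 1 * u) * (c + 1 * u) powr s
       + indicat_real {0..1} (- c + (-1) * u) * (- c + (-1) * u) powr s + exp (- (\<delta> * \<bar>u\<bar>)))"
    proof (rule AE_I2)
      fix u :: real
      define E where "E = exp (- (\<delta> * \<bar>u\<bar>))"
      have E: "0 < E" "E \<le> 1" using assms by (auto simp: E_def)
      define R where "R = indicat_real {0..1} (c + 1 * u) * (c + 1 * u) powr s
       + indicat_real {0..1} (- c + (-1) * u) * (- c + (-1) * u) powr s"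
      have "R \<ge> 0" by (simp add: R_def)
      have "\<bar>u + c\<bar> powr s * E \<le> R + E"
      proof (cases "\<bar>u + c\<bar> \<le> 1")
        case True
        have "\<bar>u + c\<bar> powr s * E \<le> \<bar>u + c\<bar> powr s * 1" using E by (intro mult_left_mono) auto
        also have "\<dots> \<le> R"
          using True by (cases "u + c \<ge> 0") (auto simp: R_def indicator_def abs_if add.commute algebra_simps)
        finally show ?thesis using E by simp
      next
        case False
        hence "\<bar>u + c\<bar> powr s \<le> 1 powr s" using assms by (intro powr_mono2') auto
        hence "\<bar>u + c\<bar> powr s * E \<le> 1 * E" using E by (intro mult_right_mono) auto
        thus ?thesis using \<open>R \<ge> 0\<close> by simp
      qed
      thus "norm (\<bar>u + c\<bar> powr s * exp (- (\<delta> * \<bar>u\<bar>)))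
         \<le> norm (indicat_real {0..1} (c + 1 * u) * (c + 1 * u) powr s
         + indicat_real {0..1} (- c + (-1) * u) * (- c + (-1) * u) powr s + exp (- (\<delta> * \<bar>u\<bar>)))"
        using E \<open>R \<ge> 0\<close> unfolding E_def R_def by simp
    qed
  qed measurable
qed

section \<open>Logarithmic powers on the upper half-plane\<close>

text \<open>
  The power \<open>(t + log a)\<^sup>k\<close> together with its derivatives, and everything that
  \<open>line_integral_sums_residues\<close> asks of it. For \<open>Im a \<ge> 0\<close> the logarithm is rotated as in
  \<open>Ln_eq_Ln_rotated\<close>; then the cut points downwards from \<open>- log a\<close>, and the boundary values on the
  real line are limits from above also where \<open>t + log a\<close> is a negative real number. For
  \<open>Im a < 0\<close> and natural \<open>k\<close> the power is a polynomial. In that case \<open>t + log a\<close> can lie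
  anywhere at a pole, but the exponents \<open>k - h\<close> that occur with nonzero factor are natural
  numbers, so the value at the pole has the same form.

  The dominating function depends on what keeps \<open>t + log a\<close> under control: for \<open>Re k \<ge> 0\<close> an upper
  bound on its modulus, for \<open>Re k < 0\<close> its distance from \<open>0\<close>, which is at least \<open>Im (log a)\<close> if
  that is positive. The remaining case, \<open>a > 0\<close> and \<open>-1 < Re k < 0\<close>, has an integrable singularity.
\<close>

lemma log_power_family:
  fixes a k :: complex
  assumes a: "a \<noteq> 0" and conv: "Im a = 0 \<and> 0 < Re a \<longrightarrow> - 1 < Re k"
    and branch: "0 \<le> Im a \<or> k \<in> \<nat>"
  obtains g :: "nat \<Rightarrow> complex \<Rightarrow> complex" and B :: "real \<Rightarrow> real" where
    "\<And>h t. 0 < Im t \<Longrightarrow> (g h has_field_derivative g (Suc h) t) (at t)"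
    "\<And>\<epsilon> \<eta>. \<lbrakk>\<epsilon> > 0; \<eta> > 0\<rbrakk> \<Longrightarrow>
       \<exists>M. \<forall>t. Im t \<ge> \<epsilon> \<longrightarrow> norm (g 0 t) \<le> M * exp (\<eta> * (\<bar>Re t\<bar> + Im t))"
    "\<And>\<delta>. \<delta> > 0 \<Longrightarrow> integrable lborel (\<lambda>u. B u * exp (- (\<delta> * \<bar>u\<bar>)))"
    "\<And>y. \<lbrakk>0 < y; y \<le> 1\<rbrakk> \<Longrightarrow> AE u in lborel. norm (g 0 (Complex u y)) \<le> B u"
    "AE u in lborel. ((\<lambda>y. g 0 (Complex u y)) \<longlongrightarrow> g 0 (of_real u)) (at_right 0)"
    "(\<lambda>u. g 0 (of_real u)) \<in> borel_measurable borel"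
    "\<And>u :: real. of_real u + Ln a \<noteq> 0 \<Longrightarrow> g 0 (of_real u) = (Ln a + of_real u) powr k"
    "\<And>h t v. \<lbrakk>0 < Im t; t + Ln a = 2 * \<i> * pi * v; v \<noteq> 0\<rbrakk> \<Longrightarrow>
       g h t = pochhammer (1 - of_nat h + k) h * ((2 * \<i> * pi) powr (k - of_nat h) * v powr (k - of_nat h))"
proof (cases "0 \<le> Im a")
  case True
  define \<alpha> where "\<alpha> = Ln a"
  have Im\<alpha>: "0 \<le> Im \<alpha>" using True a Im_Ln_pos_le[of a] by (simp add: \<alpha>_def)
  define g where "g = (\<lambda>h t. pochhammer (1 - of_nat h + k) h
                        * exp ((k - of_nat h) * (Ln (- \<i> * (t + \<alpha>)) + \<i> * pi / 2)))"
  have g_powr: "g h t = pochhammer (1 - of_nat h + k) h * (t + \<alpha>) powr (k - of_nat h)"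
    if "0 \<le> Im t" "t + \<alpha> \<noteq> 0" for h t
    using that Im\<alpha> Ln_eq_Ln_rotated[of "t + \<alpha>"] by (simp add: g_def powr_def)
  have g0: "g 0 t = (t + \<alpha>) powr k" if "0 \<le> Im t" "t + \<alpha> \<noteq> 0" for t
    using g_powr[OF that, of 0] by simp
  have nz: "t + \<alpha> \<noteq> 0" if "0 < Im t" for t
  proof -
    have "Im (t + \<alpha>) > 0" using that Im\<alpha> by simp
    thus ?thesis by force
  qed
  have norm_g: "norm (g 0 t) \<le> norm (t + \<alpha>) powr Re k * exp (pi * \<bar>Im k\<bar>)" if "0 < Im t" for t
    using g0[of t] nz[OF that] that norm_powr_le[of "t + \<alpha>" k] by simp
  have growth: "\<exists>M. \<forall>t. Im t \<ge> \<epsilon> \<longrightarrow> norm (g 0 t) \<le> M * exp (\<eta> * (\<bar>Re t\<bar> + Im t))"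
    if \<epsilon>: "\<epsilon> > 0" and \<eta>: "\<eta> > 0" for \<epsilon> \<eta>
  proof -
    obtain M where M: "M > 0" "\<And>x. x \<ge> \<epsilon> \<Longrightarrow> x powr Re k \<le> M * exp (\<eta> * x)"
      using powr_le_exp[OF \<eta> \<epsilon>] by blast
    have "norm (g 0 t) \<le> (M * exp (\<eta> * norm \<alpha>) * exp (pi * \<bar>Im k\<bar>)) * exp (\<eta> * (\<bar>Re t\<bar> + Im t))"
      if t: "Im t \<ge> \<epsilon>" for t
    proof -
      have "\<epsilon> \<le> \<bar>Im (t + \<alpha>)\<bar>" using t \<epsilon> Im\<alpha> by simp
      also have "\<dots> \<le> norm (t + \<alpha>)" by (rule abs_Im_le_cmod)
      finally have ge: "\<epsilon> \<le> norm (t + \<alpha>)" .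
      have "norm (t + \<alpha>) \<le> norm t + norm \<alpha>" by (rule norm_triangle_ineq)
      also have "norm t \<le> \<bar>Re t\<bar> + Im t" using cmod_le[of t] t \<epsilon> by simp
      finally have le: "norm (t + \<alpha>) \<le> norm \<alpha> + (\<bar>Re t\<bar> + Im t)" by simp
      have "norm (g 0 t) \<le> norm (t + \<alpha>) powr Re k * exp (pi * \<bar>Im k\<bar>)"
        using t \<epsilon> by (intro norm_g) simp
      also have "\<dots> \<le> M * exp (\<eta> * norm (t + \<alpha>)) * exp (pi * \<bar>Im k\<bar>)"
        by (intro mult_right_mono M ge) simp
      also have "\<dots> \<le> M * exp (\<eta> * (norm \<alpha> + (\<bar>Re t\<bar> + Im t))) * exp (pi * \<bar>Im k\<bar>)"
        using M(1) le \<eta> by (intro mult_right_mono mult_left_mono iffD2[OF exp_le_cancel_iff]) auto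
      finally show ?thesis by (simp add: exp_add ring_distribs mult_ac)
    qed
    thus ?thesis by blast
  qed
  define E where "E = exp (pi * \<bar>Im k\<bar>)"
  have E: "E > 0" by (simp add: E_def)
  have "\<exists>B. (\<forall>\<delta>>0. integrable lborel (\<lambda>u. B u * exp (- (\<delta> * \<bar>u\<bar>))))
          \<and> (\<forall>y. 0 < y \<longrightarrow> y \<le> 1 \<longrightarrow> (AE u in lborel. norm (Complex u y + \<alpha>) powr Re k \<le> B u))"
  proof (cases "Re k \<ge> 0")
    case Rek: True
    have "norm (Complex u y + \<alpha>) powr Re k \<le> (\<bar>u\<bar> + (norm \<alpha> + 1)) powr Re k" if "0 < y" "y \<le> 1" for u y
    proof (rule powr_mono2)
      have "norm (Complex u y + \<alpha>) \<le> norm (Complex u y) + norm \<alpha>" by (rule norm_triangle_ineq)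
      also have "norm (Complex u y) \<le> \<bar>u\<bar> + 1" using cmod_le[of "Complex u y"] that by simp
      finally show "norm (Complex u y + \<alpha>) \<le> \<bar>u\<bar> + (norm \<alpha> + 1)" by simp
    qed (use Rek in auto)
    thus ?thesis
      by (intro exI[of _ "\<lambda>u. (\<bar>u\<bar> + (norm \<alpha> + 1)) powr Re k"])
         (auto intro!: integrable_powr_mult_exp_neg_abs add_nonneg_pos)
  next
    case Rek: False
    show ?thesis
    proof (cases "Im \<alpha> = 0")
      case False
      have "norm (Complex u y + \<alpha>) powr Re k \<le> Im \<alpha> powr Re k" if "0 < y" "y \<le> 1" for u y
      proof (rule powr_mono2')
        have "Im \<alpha> \<le> \<bar>Im (Complex u y + \<alpha>)\<bar>" using that Im\<alpha> by simp
        also have "\<dots> \<le> norm (Complex u y + \<alpha>)" by (rule abs_Im_le_cmod)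
        finally show "Im \<alpha> \<le> norm (Complex u y + \<alpha>)" .
      qed (use Rek Im\<alpha> False in auto)
      thus ?thesis
        by (intro exI[of _ "\<lambda>u. Im \<alpha> powr Re k"]) (auto intro!: integrable_exp_neg_abs)
    next
      case Im0: True
      have "Im a = 0 \<and> 0 < Re a" using Im0 a unfolding \<alpha>_def by (simp add: Im_Ln_eq_0)
      hence Rek': "-1 < Re k" using conv by blast
      have "AE u in lborel. norm (Complex u y + \<alpha>) powr Re k \<le> \<bar>u + Re \<alpha>\<bar> powr Re k"
        if "0 < y" "y \<le> 1" for y
        using AE_lborel_singleton[of "- Re \<alpha>"]
      proof eventually_elim
        case (elim u)
        show ?case
        proof (rule powr_mono2')
          show "\<bar>u + Re \<alpha>\<bar> \<le> norm (Complex u y + \<alpha>)"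
            using abs_Re_le_cmod[of "Complex u y + \<alpha>"] by simp
        qed (use Rek elim in auto)
      qed
      thus ?thesis using Rek Rek'
        by (intro exI[of _ "\<lambda>u. \<bar>u + Re \<alpha>\<bar> powr Re k"])
           (auto intro!: integrable_abs_powr_mult_exp_neg_abs)
    qed
  qed
  then obtain B where B: "\<And>\<delta>. \<delta> > 0 \<Longrightarrow> integrable lborel (\<lambda>u. B u * exp (- (\<delta> * \<bar>u\<bar>)))"
    "\<And>y. \<lbrakk>0 < y; y \<le> 1\<rbrakk> \<Longrightarrow> AE u in lborel. norm (Complex u y + \<alpha>) powr Re k \<le> B u" by blast
  show ?thesis
  proof (rule that[of g "\<lambda>u. E * B u"])
    fix h t assume t: "0 < Im (t :: complex)"
    let ?L = "\<lambda>t. Ln (- \<i> * (t + \<alpha>)) + \<i> * pi / 2"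
    have not: "- \<i> * (t + \<alpha>) \<notin> \<real>\<^sub>\<le>\<^sub>0"
      using t Im\<alpha> nz[OF t] by (intro rotated_not_in_nonpos_Reals) auto
    have "(?L has_field_derivative inverse (- \<i> * (t + \<alpha>)) * (- \<i>)) (at t)"
      using not by (auto intro!: derivative_eq_intros)
    also have "inverse (- \<i> * (t + \<alpha>)) * (- \<i>) = inverse (t + \<alpha>)"
    proof -
      have *: "inverse (c * w) * c = inverse w" if "c \<noteq> 0" for c w :: complex
        using that by (cases "w = 0") (simp_all add: field_simps)
      show ?thesis by (rule *) simp
    qed
    also have "\<dots> = exp (- ?L t)"
    proof -
      have "?L t = Ln (t + \<alpha>)"
        using nz[OF t] t Im\<alpha> by (intro Ln_eq_Ln_rotated[symmetric]) auto
      hence "exp (- ?L t) = exp (- Ln (t + \<alpha>))" by (simp only:)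
      thus ?thesis using nz[OF t] by (simp add: exp_minus)
    qed
    finally have L: "(?L has_field_derivative exp (- ?L t)) (at t)" .
    have "(g h has_field_derivative pochhammer (1 - of_nat h + k) h
            * (exp ((k - of_nat h) * ?L t) * ((k - of_nat h) * exp (- ?L t)))) (at t)"
      unfolding g_def by (rule DERIV_cmult DERIV_fun_exp L)+
    also have "pochhammer (1 - of_nat h + k) h * (exp ((k - of_nat h) * ?L t) * ((k - of_nat h) * exp (- ?L t)))
        = pochhammer (1 - of_nat h + k) h * (k - of_nat h) * exp ((k - of_nat h) * ?L t + (- ?L t))"
      by (simp only: exp_add mult_ac)
    also have "(k - of_nat h) * ?L t + (- ?L t) = (k - of_nat (Suc h)) * ?L t"
      by (simp only: left_diff_distrib of_nat_Suc ring_distribs mult_1_left) simp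
    also have "pochhammer (1 - of_nat h + k) h * (k - of_nat h) * exp ((k - of_nat (Suc h)) * ?L t) = g (Suc h) t"
      unfolding g_def pochhammer_falling_Suc ..
    finally show "(g h has_field_derivative g (Suc h) t) (at t)" .
  next
    show "integrable lborel (\<lambda>u. E * B u * exp (- (\<delta> * \<bar>u\<bar>)))" if "\<delta> > 0" for \<delta>
      using integrable_mult_right[OF B(1)[OF that], of E] by (simp add: mult.assoc)
  next
    fix y :: real assume y: "0 < y" "y \<le> 1"
    show "AE u in lborel. norm (g 0 (Complex u y)) \<le> E * B u"
      using B(2)[OF y]
    proof eventually_elim
      case (elim u)
      have "norm (g 0 (Complex u y)) \<le> norm (Complex u y + \<alpha>) powr Re k * E"
        using norm_g[of "Complex u y"] y by (simp add: E_def)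
      also have "\<dots> \<le> B u * E" using elim E by (intro mult_right_mono) auto
      finally show ?case by (simp add: mult.commute)
    qed
  next
    show "AE u in lborel. ((\<lambda>y. g 0 (Complex u y)) \<longlongrightarrow> g 0 (of_real u)) (at_right 0)"
      using AE_lborel_singleton[of "- Re \<alpha>"]
    proof eventually_elim
      case (elim u)
      have "of_real u + \<alpha> \<noteq> 0" using elim by (auto simp: complex_eq_iff)
      hence "- \<i> * (of_real u + \<alpha>) \<notin> \<real>\<^sub>\<le>\<^sub>0" using Im\<alpha> by (intro rotated_not_in_nonpos_Reals) auto
      hence "isCont (g 0) (of_real u)"
        unfolding g_def by (intro continuous_intros) auto
      moreover have "((\<lambda>y. Complex u y) \<longlongrightarrow> of_real u) (at_right 0)"
        unfolding Complex_eq by (auto intro!: tendsto_eq_intros)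
      ultimately show ?case by (rule isCont_tendsto_compose)
    qed
  next
    show "(\<lambda>u. g 0 (of_real u)) \<in> borel_measurable borel"
      unfolding g_def by measurable
  next
    fix u :: real assume "of_real u + Ln a \<noteq> 0"
    thus "g 0 (of_real u) = (Ln a + of_real u) powr k"
      using g0[of "of_real u"] by (simp add: \<alpha>_def add.commute)
  next
    fix h :: nat and t v :: complex assume t: "0 < Im t" "t + Ln a = 2 * \<i> * pi * v" and v: "v \<noteq> 0"
    have "- \<i> * (t + \<alpha>) = of_real (2 * pi) * v" using t(2) by (simp add: \<alpha>_def)
    moreover have "Ln (of_real (2 * pi) * v) = Ln (of_real (2 * pi)) + Ln v"
      using v by (intro Ln_times_of_real) auto
    moreover have "Ln (of_real (2 * pi) * \<i>) = Ln (of_real (2 * pi)) + Ln \<i>"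
      by (intro Ln_times_of_real) auto
    moreover have "of_real (2 * pi) * \<i> = 2 * \<i> * pi" by simp
    ultimately have L: "Ln (- \<i> * (t + \<alpha>)) + \<i> * pi / 2 = Ln (2 * \<i> * pi) + Ln v"
      by (simp only: Ln_ii) simp
    have "exp ((k - of_nat h) * (Ln (2 * \<i> * pi) + Ln v))
            = (2 * \<i> * pi) powr (k - of_nat h) * v powr (k - of_nat h)"
      using v by (simp add: powr_def distrib_left exp_add)
    thus "g h t = pochhammer (1 - of_nat h + k) h * ((2 * \<i> * pi) powr (k - of_nat h) * v powr (k - of_nat h))"
      by (simp only: g_def L)
  qed (rule growth)
next
  case False
  then obtain K where k: "k = of_nat K" using branch by (auto elim: Nats_cases)
  define \<alpha> where "\<alpha> = Ln a"
  define g where "g = (\<lambda>h t. pochhammer (1 - of_nat h + k) h * (t + \<alpha>) ^ (K - h))"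
  define C where "C = norm \<alpha> + 1"
  have C: "C > 0" by (simp add: C_def add_nonneg_pos)
  have g0: "g 0 t = (t + \<alpha>) ^ K" for t by (simp add: g_def)
  have poch0: "pochhammer (1 - of_nat h + k) h = 0" if "K < h" for h
    unfolding k pochhammer_eq_0_iff using that
    by (intro exI[of _ "h - Suc K"]) (auto simp: of_nat_diff)
  have norm_g: "norm (g 0 t) \<le> (norm t + C) powr K" for t
  proof -
    have "norm (g 0 t) \<le> (norm t + norm \<alpha>) ^ K"
      unfolding g0 norm_power by (intro power_mono norm_triangle_ineq) auto
    also have "\<dots> \<le> (norm t + C) ^ K" by (intro power_mono) (auto simp: C_def)
    also have "\<dots> = (norm t + C) powr K" using C by (subst powr_realpow) (auto intro: add_nonneg_pos)
    finally show ?thesis .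
  qed
  show ?thesis
  proof (rule that[of g "\<lambda>u. (\<bar>u\<bar> + (C + 1)) powr K"])
    fix h t assume t: "0 < Im (t :: complex)"
    have "(g h has_field_derivative pochhammer (1 - of_nat h + k) h * (of_nat (K - h) * (t + \<alpha>) ^ (K - Suc h))) (at t)"
      unfolding g_def by (auto intro!: derivative_eq_intros)
    also have "pochhammer (1 - of_nat h + k) h * (of_nat (K - h) * (t + \<alpha>) ^ (K - Suc h)) = g (Suc h) t"
    proof (cases "h \<le> K")
      case True
      thus ?thesis unfolding g_def pochhammer_falling_Suc by (simp add: k of_nat_diff mult.assoc)
    next
      case False
      thus ?thesis using poch0[of h] poch0[of "Suc h"] by (simp add: g_def)
    qed
    finally show "(g h has_field_derivative g (Suc h) t) (at t)" .
  next
    fix \<epsilon> \<eta> :: real assume "\<epsilon> > 0" and \<eta>: "\<eta> > 0"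
    obtain M where M: "M > 0" "\<And>x. x \<ge> C \<Longrightarrow> x powr K \<le> M * exp (\<eta> * x)"
      using powr_le_exp[OF \<eta> C] by blast
    have "norm (g 0 t) \<le> (M * exp (\<eta> * C)) * exp (\<eta> * (\<bar>Re t\<bar> + Im t))" if t: "Im t \<ge> \<epsilon>" for t
    proof -
      have le: "norm t \<le> \<bar>Re t\<bar> + Im t" using cmod_le[of t] t \<open>\<epsilon> > 0\<close> by simp
      have "norm (g 0 t) \<le> (norm t + C) powr K" by (rule norm_g)
      also have "\<dots> \<le> M * exp (\<eta> * (norm t + C))" by (intro M) simp
      also have "\<dots> \<le> M * exp (\<eta> * (\<bar>Re t\<bar> + Im t + C))"
        using M(1) le \<eta> by (intro mult_left_mono iffD2[OF exp_le_cancel_iff]) auto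
      finally show ?thesis by (simp add: exp_add ring_distribs mult_ac)
    qed
    thus "\<exists>M. \<forall>t. Im t \<ge> \<epsilon> \<longrightarrow> norm (g 0 t) \<le> M * exp (\<eta> * (\<bar>Re t\<bar> + Im t))" by blast
  next
    show "integrable lborel (\<lambda>u. (\<bar>u\<bar> + (C + 1)) powr K * exp (- (\<delta> * \<bar>u\<bar>)))" if "\<delta> > 0" for \<delta>
      using C that by (intro integrable_powr_mult_exp_neg_abs) auto
  next
    fix y :: real assume y: "0 < y" "y \<le> 1"
    have "norm (g 0 (Complex u y)) \<le> (\<bar>u\<bar> + (C + 1)) powr K" for u
    proof -
      have "norm (g 0 (Complex u y)) \<le> (norm (Complex u y) + C) powr K" by (rule norm_g)
      also have "\<dots> \<le> (\<bar>u\<bar> + (C + 1)) powr K"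
        using cmod_le[of "Complex u y"] y C by (intro powr_mono2) auto
      finally show ?thesis .
    qed
    thus "AE u in lborel. norm (g 0 (Complex u y)) \<le> (\<bar>u\<bar> + (C + 1)) powr K" by simp
  next
    have "((\<lambda>y. g 0 (Complex u y)) \<longlongrightarrow> g 0 (of_real u)) (at_right 0)" for u
      unfolding g0 Complex_eq by (auto intro!: tendsto_eq_intros)
    thus "AE u in lborel. ((\<lambda>y. g 0 (Complex u y)) \<longlongrightarrow> g 0 (of_real u)) (at_right 0)" by simp
  next
    show "(\<lambda>u. g 0 (of_real u)) \<in> borel_measurable borel"
      unfolding g0 by measurable
  next
    fix u :: real assume "of_real u + Ln a \<noteq> 0"
    thus "g 0 (of_real u) = (Ln a + of_real u) powr k"
      by (simp add: g0 k \<alpha>_def add.commute)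
  next
    fix h :: nat and t v :: complex assume t: "0 < Im t" "t + Ln a = 2 * \<i> * pi * v" and v: "v \<noteq> 0"
    show "g h t = pochhammer (1 - of_nat h + k) h * ((2 * \<i> * pi) powr (k - of_nat h) * v powr (k - of_nat h))"
    proof (cases "h \<le> K")
      case True
      hence "k - of_nat h = of_nat (K - h)" by (simp add: k of_nat_diff)
      thus ?thesis using v t(2) by (simp add: g_def \<alpha>_def power_mult_distrib)
    next
      case False
      thus ?thesis using poch0[of h] by (simp add: g_def)
    qed
  qed
qed

section \<open>Kernels with one family of poles\<close>

text \<open>
  The powers \<open>(q + v)\<^sup>s\<close> grow more slowly than any geometric sequence with ratio above \<open>1\<close>; half of the decay of
  \<open>z\<^sup>q\<close> absorbs them.
\<close>

lemma summable_hurwitz_lerch: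
  fixes z s v :: complex
  assumes "norm z < 1" "z \<noteq> 0"
  shows "summable (\<lambda>q. z ^ q * (of_nat q + v) powr s)"
proof -
  define \<eta> where "\<eta> = - ln (norm z) / 2"
  have \<eta>: "\<eta> > 0" using assms by (simp add: \<eta>_def)
  have zn: "norm z = exp (- 2 * \<eta>)" using assms by (simp add: \<eta>_def)
  obtain M where M: "M > 0" "\<And>x. x \<ge> 1 \<Longrightarrow> x powr Re s \<le> M * exp (\<eta> * x)"
    using powr_le_exp[OF \<eta> zero_less_one] by blast
  define C where "C = M * exp (\<eta> * norm v) * exp (pi * \<bar>Im s\<bar>)"
  show ?thesis
  proof (rule summable_comparison_test_ev)
    show "summable (\<lambda>q. C * exp (- \<eta>) ^ q)"
      using \<eta> by (intro summable_mult summable_geometric) auto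
    show "eventually (\<lambda>q. norm (z ^ q * (of_nat q + v) powr s) \<le> C * exp (- \<eta>) ^ q) sequentially"
      using eventually_ge_at_top[of "nat \<lceil>norm v + 1\<rceil>"]
    proof eventually_elim
      case (elim q)
      hence q: "real q \<ge> norm v + 1" by linarith
      have "norm (of_nat q :: complex) - norm v \<le> norm (of_nat q + v)" by (rule norm_diff_ineq)
      hence ge: "1 \<le> norm (of_nat q + v)" using q by simp
      have "norm (of_nat q + v) \<le> norm (of_nat q :: complex) + norm v" by (rule norm_triangle_ineq)
      hence le: "norm (of_nat q + v) \<le> real q + norm v" by simp
      have "norm (z ^ q * (of_nat q + v) powr s)
              \<le> exp (- 2 * \<eta>) ^ q * (norm (of_nat q + v) powr Re s * exp (pi * \<bar>Im s\<bar>))"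
        unfolding norm_mult norm_power zn by (intro mult_left_mono norm_powr_le) auto
      also have "\<dots> \<le> exp (- 2 * \<eta>) ^ q * (M * exp (\<eta> * norm (of_nat q + v)) * exp (pi * \<bar>Im s\<bar>))"
        by (intro mult_left_mono mult_right_mono M ge) auto
      also have "\<dots> \<le> exp (- 2 * \<eta>) ^ q * (M * exp (\<eta> * (real q + norm v)) * exp (pi * \<bar>Im s\<bar>))"
        using M(1) le \<eta> by (intro mult_left_mono mult_right_mono iffD2[OF exp_le_cancel_iff]) auto
      also have "\<dots> = C * (exp (- 2 * \<eta>) ^ q * exp (\<eta> * real q))"
        by (simp add: C_def exp_add ring_distribs mult_ac)
      also have "exp (- 2 * \<eta>) ^ q * exp (\<eta> * real q) = exp (- \<eta>) ^ q"
        by (simp add: algebra_simps flip: exp_of_nat_mult exp_add)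
      finally show ?case .
    qed
  qed
qed

text \<open>
  The case of a single pole family, on the line. At the pole with index \<open>q\<close> the exponentials contribute
  \<open>e\<^bsup>(m - 1) t\<^esup> = - \<gamma>\<^bsup>m - 1\<^esup> (-1)\<^sup>m e\<^bsup>2 \<pi> i m q\<^esup>\<close> and \<open>e\<^bsup>-j t\<^esup> = (-\<gamma>)\<^bsup>-j\<^esup>\<close>, and the logarithm
  contributes \<open>(2 \<pi> i)\<^bsup>k - h\<^esup> (q + v)\<^bsup>k - h\<^esup>\<close>. Summation over \<open>q\<close> then gives Hurwitz-Lerch values.
\<close>

lemma exp_kernel_integral:
  fixes a \<gamma> k m :: complex
  assumes a: "a \<noteq> 0" "Im a = 0 \<and> 0 < Re a \<longrightarrow> - 1 < Re k" "0 \<le> Im a \<or> k \<in> \<nat>"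
    and \<gamma>: "\<gamma> \<noteq> 0" "\<bar>Arg \<gamma>\<bar> < pi"
    and m: "0 < Re m" "Re m < 1" "0 < Im m"
    and v_def: "v = - (\<i> * (\<i> * pi + ln a + ln \<gamma>)) / (2 * pi)"
    and v: "v \<notin> \<int>\<^sub>\<le>\<^sub>0"
  shows "integrable lborel (\<lambda>u. exp (m * of_real u) * (ln a + of_real u) powr k / (exp (of_real u) + \<gamma>) ^ Suc j)"
      (is "integrable lborel ?F")
    and "(LINT u|lborel. exp (m * of_real u) * (ln a + of_real u) powr k / (exp (of_real u) + \<gamma>) ^ Suc j)
      = - (\<Sum>p\<le>j. \<Sum>l\<le>p. \<Sum>h\<le>p - l.
           (- 1) ^ j * (- 1) powr m * \<gamma> powr (m - 1) / (\<gamma> ^ j * fact j)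
           * (of_int (signed_stirling1 j p) * (of_nat (p choose l) * of_nat ((p - l) choose h) * (- 1) ^ l * m ^ (p - l - h)))
           * (pochhammer (1 - of_nat h + k) h * (2 * \<i> * pi) powr (1 - of_nat h + k))
           * hurwitz_lerch (exp (2 * \<i> * pi * m)) (of_nat h - k) v)"
      (is "?I = - ?S")
proof -
  obtain g B where
    D: "\<And>h t. 0 < Im t \<Longrightarrow> (g h has_field_derivative g (Suc h) t) (at t)" and
    growth: "\<And>\<epsilon> \<eta>. \<lbrakk>\<epsilon> > 0; \<eta> > 0\<rbrakk> \<Longrightarrow>
       \<exists>M. \<forall>t. Im t \<ge> \<epsilon> \<longrightarrow> norm (g 0 t) \<le> M * exp (\<eta> * (\<bar>Re t\<bar> + Im t))" and
    dom: "\<And>\<delta>. \<delta> > 0 \<Longrightarrow> integrable lborel (\<lambda>u. B u * exp (- (\<delta> * \<bar>u\<bar>)))"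
      "\<And>y. \<lbrakk>0 < y; y \<le> 1\<rbrakk> \<Longrightarrow> AE u in lborel. norm (g 0 (Complex u y)) \<le> B u" and
    lim: "AE u in lborel. ((\<lambda>y. g 0 (Complex u y)) \<longlongrightarrow> g 0 (of_real u)) (at_right 0)" and
    meas: "(\<lambda>u. g 0 (of_real u)) \<in> borel_measurable borel" and
    g_real: "\<And>u :: real. of_real u + ln a \<noteq> 0 \<Longrightarrow> g 0 (of_real u) = (ln a + of_real u) powr k" and
    g_pole: "\<And>h t v. \<lbrakk>0 < Im t; t + ln a = 2 * \<i> * pi * v; v \<noteq> 0\<rbrakk> \<Longrightarrow>
       g h t = pochhammer (1 - of_nat h + k) h * ((2 * \<i> * pi) powr (k - of_nat h) * v powr (k - of_nat h))"
    by (rule log_power_family[OF a]) blast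
  define X where "X = falling_exp_deriv (m - 1) g"
  define F where "F = (\<lambda>u. exp (m * of_real u) * g 0 (of_real u) / (exp (of_real u) + \<gamma>) ^ Suc j)"
  define z where "z = exp (2 * \<i> * pi * m)"
  define t where "t = (\<lambda>q. Ln \<gamma> + \<i> * pi + 2 * pi * \<i> * of_nat q)"
  have X: "(X i has_field_derivative exp t * X (Suc i) t) (at t)" if "0 < Im t" for i t
    unfolding X_def by (intro has_field_derivative_falling_exp_deriv D that)
  have X0: "exp t * X 0 t = exp (m * t) * g 0 t" for t
    by (simp add: X_def falling_exp_deriv_def exp_product_deriv_def algebra_simps flip: exp_add)
  note main = line_integral_sums_residues[OF \<gamma> m X X0 growth dom lim meas, of j]
  have int: "integrable lborel F" unfolding F_def by (rule main(1))
  have sums: "(\<lambda>q. 2 * pi * \<i> * X j (t q) / fact j) sums integral\<^sup>L lborel F"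
    unfolding F_def t_def by (rule main(2))
  \<comment> \<open>the two differ at most where \<open>log a + u = 0\<close>, where \<open>powr\<close> has the default value \<open>0\<close>\<close>
  have AE: "AE u in lborel. ?F u = F u"
    using AE_lborel_singleton[of "- Re (ln a)"]
  proof eventually_elim
    case (elim u)
    hence "of_real u + ln a \<noteq> 0" by (auto simp: complex_eq_iff)
    thus ?case by (simp add: F_def g_real)
  qed
  have meas': "?F \<in> borel_measurable lborel" by measurable
  show "integrable lborel ?F"
    using int by (subst integrable_cong_AE[OF meas' _ AE]) auto
  have I: "?I = integral\<^sup>L lborel F"
    using int by (intro integral_cong_AE[OF meas' _ AE]) auto

  define c where "c = (- 1) ^ j * (- 1) powr m * \<gamma> powr (m - 1) / (\<gamma> ^ j * fact j)"
  define K where "K = (\<lambda>p l h. of_int (signed_stirling1 j p)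
      * (of_nat (p choose l) * of_nat ((p - l) choose h) * (- 1) ^ l * m ^ (p - l - h)))"
  define P where "P = (\<lambda>h. pochhammer (1 - of_nat h + k) h * (2 * \<i> * pi) powr (1 - of_nat h + k))"
  have z: "norm z < 1" "z \<noteq> 0" using m by (auto simp: z_def)
  have residue: "2 * pi * \<i> * X j (t q) / fact j
      = - (\<Sum>p\<le>j. \<Sum>l\<le>p. \<Sum>h\<le>p - l. c * K p l h * P h * (z ^ q * (of_nat q + v) powr (k - of_nat h)))" for q
  proof -
    have Im: "0 < Im (t q)"
    proof -
      have "Im (t q) = Arg \<gamma> + pi + 2 * pi * real q" using \<gamma> by (simp add: t_def Arg_eq_Im_Ln)
      moreover have "0 < Arg \<gamma> + pi" using \<gamma> by linarith
      ultimately show ?thesis by (simp add: add_pos_nonneg)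
    qed
    have arg: "t q + ln a = 2 * \<i> * pi * (of_nat q + v)"
      by (simp add: t_def v_def field_simps)
    have nz: "of_nat q + v \<noteq> 0"
    proof
      assume "of_nat q + v = 0"
      hence "v = - of_nat q" by (simp add: eq_neg_iff_add_eq_0 add.commute)
      thus False using v by simp
    qed
    have et: "exp (t q) = - \<gamma>"
    proof -
      have "exp (t q) = exp (Ln \<gamma>) * exp (\<i> * pi) * exp (2 * pi * \<i> * of_nat q)"
        unfolding t_def exp_add ..
      also have "exp (2 * pi * \<i> * of_nat q) = 1"
        using exp_of_nat_mult[of q "2 * pi * \<i>"] by (simp add: mult_ac)
      finally show ?thesis using \<gamma> by simp
    qed
    have e1: "exp (- of_nat j * t q) = (- 1) ^ j / \<gamma> ^ j"
    proof -
      have "exp (- of_nat j * t q) = inverse (exp (of_nat j * t q))" by (simp add: exp_minus)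
      also have "\<dots> = inverse ((- \<gamma>) ^ j)" by (simp only: exp_of_nat_mult et)
      also have "\<dots> = (- 1) ^ j / \<gamma> ^ j"
        by (simp add: power_minus[of \<gamma>] divide_inverse flip: power_inverse)
      finally show ?thesis .
    qed
    have e2: "exp ((m - 1) * t q) = - (\<gamma> powr (m - 1) * (- 1) powr m * z ^ q)"
    proof -
      have "exp ((m - 1) * t q) = exp ((m - 1) * Ln \<gamma>) * exp ((m - 1) * (\<i> * pi))
                                    * exp (of_nat q * (2 * \<i> * pi * (m - 1)))"
        unfolding exp_add[symmetric] by (rule arg_cong[where f = exp]) (simp add: t_def algebra_simps)
      also have "exp (of_nat q * (2 * \<i> * pi * (m - 1))) = exp (2 * \<i> * pi * (m - 1)) ^ q"
        by (rule exp_of_nat_mult)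
      also have "exp (2 * \<i> * pi * (m - 1)) = z"
        by (simp add: z_def ring_distribs exp_diff mult_ac)
      also have "exp ((m - 1) * (\<i> * pi)) = - ((- 1) powr m)"
        by (simp add: powr_def ring_distribs exp_diff)
      also have "exp ((m - 1) * Ln \<gamma>) = \<gamma> powr (m - 1)" using \<gamma> by (simp add: powr_def)
      finally show ?thesis by simp
    qed
    have "X j (t q) = exp (- of_nat j * t q) * exp ((m - 1) * t q)
        * (\<Sum>p\<le>j. of_int (signed_stirling1 j p) * (\<Sum>h\<le>p. of_nat (p choose h) * (m - 1) ^ (p - h) * g h (t q)))"
      unfolding X_def falling_exp_deriv_def exp_product_deriv_def
      by (simp add: sum_distrib_left mult_ac)
    also have "(\<Sum>p\<le>j. of_int (signed_stirling1 j p) * (\<Sum>h\<le>p. of_nat (p choose h) * (m - 1) ^ (p - h) * g h (t q)))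
        = (\<Sum>p\<le>j. \<Sum>l\<le>p. \<Sum>h\<le>p - l. K p l h * g h (t q))"
      unfolding sum_binomial_shift_by_minus_one by (simp add: K_def sum_distrib_left mult.assoc)
    finally have Xj: "X j (t q) = exp (- of_nat j * t q) * exp ((m - 1) * t q)
        * (\<Sum>p\<le>j. \<Sum>l\<le>p. \<Sum>h\<le>p - l. K p l h * g h (t q))" .
    have gP: "2 * pi * \<i> * g h (t q) = P h * (of_nat q + v) powr (k - of_nat h)" for h
    proof -
      have "(2 * \<i> * pi) powr (1 - of_nat h + k) = (2 * \<i> * pi) powr (1 + (k - of_nat h))"
        by (simp add: algebra_simps)
      also have "\<dots> = 2 * \<i> * pi * (2 * \<i> * pi) powr (k - of_nat h)"
        by (subst powr_add) simp
      finally show ?thesis by (simp add: g_pole[OF Im arg nz] P_def mult_ac)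
    qed
    have "2 * pi * \<i> * X j (t q) / fact j
        = - (\<Sum>p\<le>j. \<Sum>l\<le>p. \<Sum>h\<le>p - l. c * z ^ q * (K p l h * (2 * pi * \<i> * g h (t q))))"
      unfolding Xj e1 e2 c_def by (simp add: sum_distrib_left sum_divide_distrib sum_negf mult_ac)
    thus ?thesis unfolding gP by (simp add: mult_ac)
  qed
  have "(\<lambda>q. z ^ q * (of_nat q + v) powr (k - of_nat h)) sums hurwitz_lerch z (of_nat h - k) v" for h
    using summable_sums[OF summable_hurwitz_lerch[OF z, of v "k - of_nat h"]]
    by (simp add: hurwitz_lerch_def)
  hence "(\<lambda>q. 2 * pi * \<i> * X j (t q) / fact j) sums
      - (\<Sum>p\<le>j. \<Sum>l\<le>p. \<Sum>h\<le>p - l. c * K p l h * P h * hurwitz_lerch z (of_nat h - k) v)"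
    unfolding residue by (intro sums_minus sums_sum sums_mult)
  hence "integral\<^sup>L lborel F
      = - (\<Sum>p\<le>j. \<Sum>l\<le>p. \<Sum>h\<le>p - l. c * K p l h * P h * hurwitz_lerch z (of_nat h - k) v)"
    using sums sums_unique2 by blast
  thus "?I = - ?S" unfolding I c_def K_def P_def z_def .
qed

lemma set_integral_Ioi_exp_substitution:
  fixes f :: "real \<Rightarrow> complex"
  assumes meas: "f \<in> borel_measurable borel"
    and int: "integrable lborel (\<lambda>u. of_real (exp u) * f (exp u))"
  shows "set_integrable lborel {0<..} f"
    and "(LBINT x:{0<..}. f x) = (LINT u|lborel. of_real (exp u) * f (exp u))"
proof -
  have "set_integrable lborel UNIV (\<lambda>u. of_real (exp u) * f (exp u))"
    using int by (simp add: set_integrable_def)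
  from set_borel_integral_eq_integral[OF this]
  have I: "integral UNIV (\<lambda>u. of_real (exp u) * f (exp u)) = (LINT u|lborel. of_real (exp u) * f (exp u))"
    by (simp add: set_lebesgue_integral_def)
  have "integrable lebesgue (\<lambda>u. of_real (exp u) * f (exp u))"
    using int by (subst integrable_completion) auto
  hence "(\<lambda>u. \<bar>exp u\<bar> *\<^sub>R f (exp u)) absolutely_integrable_on UNIV"
    by (simp add: set_integrable_def scaleR_conv_of_real)
  moreover have "integral UNIV (\<lambda>u. \<bar>exp u\<bar> *\<^sub>R f (exp u)) = (LINT u|lborel. of_real (exp u) * f (exp u))"
    using I by (simp add: scaleR_conv_of_real)
  moreover have "exp ` (UNIV :: real set) = {0<..}"
    by (auto simp: image_iff) (metis exp_ln)
  moreover have "(\<lambda>u. \<bar>exp u\<bar> *\<^sub>R f (exp u)) absolutely_integrable_on UNIV \<and>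
         integral UNIV (\<lambda>u. \<bar>exp u\<bar> *\<^sub>R f (exp u)) = b
         \<longleftrightarrow> f absolutely_integrable_on exp ` UNIV \<and> integral (exp ` UNIV) f = b" for b
    by (rule has_absolute_integral_change_of_variables_real)
       (auto intro!: DERIV_subset[OF DERIV_exp] inj_onI)
  ultimately have ai: "f absolutely_integrable_on {0<..}"
    and eq: "integral {0<..} f = (LINT u|lborel. of_real (exp u) * f (exp u))"
    by metis+
  have "integrable lebesgue (\<lambda>x. indicator {0<..} x *\<^sub>R f x)"
    using ai by (simp add: set_integrable_def)
  thus si: "set_integrable lborel {0<..} f"
    unfolding set_integrable_def using meas by (subst (asm) integrable_completion) auto
  show "(LBINT x:{0<..}. f x) = (LINT u|lborel. of_real (exp u) * f (exp u))"
    using set_borel_integral_eq_integral(2)[OF si] eq by simp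
qed

text \<open>
  The sum is a finite geometric series in \<open>d / y\<close>; with \<open>y = x + \<gamma>\<close> and \<open>d = \<gamma> - b\<close> the
  left-hand side is the rational factor of the integrand.
\<close>

lemma partial_fraction_repeated_pole:
  fixes y d :: "'a :: field"
  assumes "y \<noteq> 0" "d \<noteq> 0" "y \<noteq> d"
  shows "1 / ((y - d) * y ^ n) = (1 / (y - d) - (\<Sum>j<n. d ^ j / y ^ Suc j)) / d ^ n"
proof (induction n)
  case (Suc n)
  have "1 / ((y - d) * y ^ Suc n) = (1 / ((y - d) * y ^ n) - 1 / y ^ Suc n) / d"
  proof -
    have "y - d \<noteq> 0" using assms by simp
    thus ?thesis using assms by (simp add: divide_simps)
  qed
  also have "1 / y ^ Suc n = (d ^ n / y ^ Suc n) / d ^ n" using assms by simp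
  finally have "1 / ((y - d) * y ^ Suc n)
      = ((1 / (y - d) - (\<Sum>j<n. d ^ j / y ^ Suc j)) / d ^ n - (d ^ n / y ^ Suc n) / d ^ n) / d"
    unfolding Suc.IH .
  moreover have "(A / D - E / D) / d = (A - E) / (d * D)" for A D E :: 'a
    by (simp add: diff_divide_distrib mult.commute)
  ultimately show ?case by (simp only: sum.lessThan_Suc diff_diff_eq power_Suc)
qed simp

section \<open>The integral\<close>

theorem theorem4p1:
  fixes n :: nat and b \<gamma> k a m :: complex
  assumes "n > 0"
    and "b \<noteq> 0" and "\<bar>Arg b\<bar> < pi"
    and "\<gamma> \<noteq> 0" and "\<bar>Arg \<gamma>\<bar> < pi"
    and "b \<noteq> \<gamma>"
    and "a \<noteq> 0"
    and "0 < Re m" and "Re m < 1"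
    and "0 < Im m" and "Im m < 1"
    \<comment> \<open>the Hurwitz-Lerch functions on the right-hand side are defined\<close>
    and "- (\<i> * (\<i> * pi + ln a + ln b)) / (2 * pi) \<notin> \<int>\<^sub>\<le>\<^sub>0"
    and "- (\<i> * (\<i> * pi + ln a + ln \<gamma>)) / (2 * pi) \<notin> \<int>\<^sub>\<le>\<^sub>0"
    \<comment> \<open>for positive real \<open>a\<close> the logarithm vanishes at \<open>x = 1 / a\<close>: convergence there\<close>
    and "Im a = 0 \<and> 0 < Re a \<longrightarrow> - 1 < Re k"
    \<comment> \<open>validity of the principal branch of the \<open>k\<close>-th power; the identity fails without it\<close>
    and "0 \<le> Im a \<or> k \<in> \<nat>"
  shows "set_integrable lborel {0<..} (log_integrand n b \<gamma> k a m) \<and>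
    (LBINT x:{0<..}. log_integrand n b \<gamma> k a m x) =
      b powr (m - 1) * (- 1) powr (m + 1) * (2 * \<i> * pi) powr (k + 1)
        * (\<gamma> - b) powi (- int n)
        * hurwitz_lerch (exp (2 * \<i> * pi * m)) (- k)
            (- (\<i> * (\<i> * pi + ln a + ln b)) / (2 * pi))
      + (\<Sum>j=0..n - 1. \<Sum>p=0..j. \<Sum>l=0..p. \<Sum>h=0..p - l.
          (- 1) ^ (j - l) * (- 1) powr m * m ^ (p - l - h)
            * (2 * \<i> * pi) powr (1 - of_nat h + k)
            * \<gamma> powr (m - 1) * (\<gamma> - b) powi (- int n) * ((\<gamma> - b) / \<gamma>) ^ j / fact j
            * of_nat (p choose l) * of_nat ((p - l) choose h)
            * pochhammer (1 - of_nat h + k) h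
            * hurwitz_lerch (exp (2 * \<i> * pi * m)) (of_nat h - k)
                (- (\<i> * (\<i> * pi + ln a + ln \<gamma>)) / (2 * pi))
            * of_int (signed_stirling1 j p))"
proof -
  define vb where "vb = - (\<i> * (\<i> * pi + ln a + ln b)) / (2 * pi)"
  define v where "v = - (\<i> * (\<i> * pi + ln a + ln \<gamma>)) / (2 * pi)"
  define z where "z = exp (2 * \<i> * pi * m)"
  define d where "d = \<gamma> - b"
  define F where "F = (\<lambda>c j u. exp (m * of_real u) * (ln a + of_real u) powr k / (exp (of_real u) + c) ^ Suc j)"
  define I where "I = (\<lambda>c j. LINT u|lborel. F c j u)"
  define T where "T = (\<lambda>j p l h. (- 1) ^ j * (- 1) powr m * \<gamma> powr (m - 1) / (\<gamma> ^ j * fact j)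
           * (of_int (signed_stirling1 j p) * (of_nat (p choose l) * of_nat ((p - l) choose h) * (- 1) ^ l * m ^ (p - l - h)))
           * (pochhammer (1 - of_nat h + k) h * (2 * \<i> * pi) powr (1 - of_nat h + k))
           * hurwitz_lerch z (of_nat h - k) v)"
  note a = \<open>a \<noteq> 0\<close> \<open>Im a = 0 \<and> 0 < Re a \<longrightarrow> - 1 < Re k\<close> \<open>0 \<le> Im a \<or> k \<in> \<nat>\<close>
  note m = \<open>0 < Re m\<close> \<open>Re m < 1\<close> \<open>0 < Im m\<close>
  have vs: "vb \<notin> \<int>\<^sub>\<le>\<^sub>0" "v \<notin> \<int>\<^sub>\<le>\<^sub>0" using assms(12,13) unfolding vb_def v_def by -
  note b_kernel = exp_kernel_integral[OF a \<open>b \<noteq> 0\<close> \<open>\<bar>Arg b\<bar> < pi\<close> m vb_def vs(1), of 0]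
  note \<gamma>_kernel = exp_kernel_integral[OF a \<open>\<gamma> \<noteq> 0\<close> \<open>\<bar>Arg \<gamma>\<bar> < pi\<close> m v_def vs(2)]
  have d: "d \<noteq> 0" using \<open>b \<noteq> \<gamma>\<close> by (simp add: d_def)
  have F_int: "integrable lborel (F b 0)" "integrable lborel (F \<gamma> j)" for j
    unfolding F_def by (rule b_kernel(1), rule \<gamma>_kernel(1))
  have I_b: "I b 0 = - ((- 1) powr m * b powr (m - 1) * (2 * \<i> * pi) powr (1 + k) * hurwitz_lerch z (- k) vb)"
    unfolding I_def F_def b_kernel(2) z_def by simp
  have I_\<gamma>: "I \<gamma> j = - (\<Sum>p\<le>j. \<Sum>l\<le>p. \<Sum>h\<le>p - l. T j p l h)" for j
    unfolding I_def F_def \<gamma>_kernel(2) T_def z_def ..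
  have nz: "exp (of_real u) + c \<noteq> 0" if "\<bar>Arg c\<bar> < pi" "c \<noteq> 0" for c and u :: real
  proof
    assume "exp (of_real u) + c = 0"
    hence "c = of_real (- exp u)" by (simp add: eq_neg_iff_add_eq_0 add.commute flip: exp_of_real)
    hence "Arg c = pi" by (simp only: Arg_of_real) simp
    thus False using that by simp
  qed
  have integrand: "of_real (exp u) * log_integrand n b \<gamma> k a m (exp u)
      = (F b 0 u - (\<Sum>j<n. d ^ j * F \<gamma> j u)) / d ^ n" for u :: real
  proof -
    define x where "x = exp (complex_of_real u)"
    define G where "G = exp (m * of_real u) * (ln a + of_real u) powr k"
    have x: "x \<noteq> 0" by (simp add: x_def)
    have y: "x + \<gamma> \<noteq> 0" "x + b \<noteq> 0"
      unfolding x_def by (rule nz[OF assms(5,4)], rule nz[OF assms(3,2)])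
    have yd: "x + \<gamma> - d = x + b" by (simp add: d_def)
    have "x powr (m - 1) = exp ((m - 1) * of_real u)"
      unfolding powr_def x_def by simp
    hence "x * x powr (m - 1) = exp (m * of_real u)"
      by (simp add: x_def algebra_simps flip: exp_add)
    hence "of_real (exp u) * log_integrand n b \<gamma> k a m (exp u) = G * (1 / ((x + \<gamma> - d) * (x + \<gamma>) ^ n))"
      unfolding yd by (simp add: log_integrand_def G_def x_def exp_of_real[symmetric] add.commute mult.assoc[symmetric])
    also have "\<dots> = G * ((1 / (x + b) - (\<Sum>j<n. d ^ j / (x + \<gamma>) ^ Suc j)) / d ^ n)"
      using y d yd by (subst partial_fraction_repeated_pole) auto
    also have "\<dots> = (F b 0 u - (\<Sum>j<n. d ^ j * F \<gamma> j u)) / d ^ n"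
      unfolding F_def G_def[symmetric] x_def[symmetric]
      by (simp add: right_diff_distrib sum_distrib_left mult_ac del: power_Suc)
    finally show ?thesis .
  qed
  have meas: "log_integrand n b \<gamma> k a m \<in> borel_measurable borel"
    unfolding log_integrand_def[abs_def] by measurable
  have int: "integrable lborel (\<lambda>u. of_real (exp u) * log_integrand n b \<gamma> k a m (exp u))"
    unfolding integrand
    by (intro integrable_divide Bochner_Integration.integrable_diff Bochner_Integration.integrable_sum
              integrable_mult_right F_int)
  have "(LBINT x:{0<..}. log_integrand n b \<gamma> k a m x)
      = (LINT u|lborel. (F b 0 u - (\<Sum>j<n. d ^ j * F \<gamma> j u)) / d ^ n)"
    unfolding set_integral_Ioi_exp_substitution(2)[OF meas int] integrand ..
  also have "\<dots> = (I b 0 - (\<Sum>j<n. d ^ j * I \<gamma> j)) / d ^ n"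
    unfolding I_def
    by (simp add: Bochner_Integration.integral_diff Bochner_Integration.integrable_sum
          Bochner_Integration.integral_sum F_int integrable_mult_right)
  also have "\<dots> = I b 0 / d ^ n + (\<Sum>j<n. \<Sum>p\<le>j. \<Sum>l\<le>p. \<Sum>h\<le>p - l. d ^ j * T j p l h / d ^ n)"
    unfolding I_\<gamma> by (simp add: diff_divide_distrib add_divide_distrib sum_divide_distrib sum_distrib_left sum_negf)
  also have "I b 0 / d ^ n = b powr (m - 1) * (- 1) powr (m + 1) * (2 * \<i> * pi) powr (k + 1)
        * d powi (- int n) * hurwitz_lerch z (- k) vb"
  proof -
    have "(- 1 :: complex) powr (m + 1) = - ((- 1) powr m)" by (simp add: powr_add)
    thus ?thesis unfolding I_b
      by (simp add: power_int_minus divide_inverse add.commute[of 1 k] mult_ac)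
  qed
  also have "(\<Sum>j<n. \<Sum>p\<le>j. \<Sum>l\<le>p. \<Sum>h\<le>p - l. d ^ j * T j p l h / d ^ n)
      = (\<Sum>j=0..n - 1. \<Sum>p=0..j. \<Sum>l=0..p. \<Sum>h=0..p - l.
          (- 1) ^ (j - l) * (- 1) powr m * m ^ (p - l - h)
            * (2 * \<i> * pi) powr (1 - of_nat h + k)
            * \<gamma> powr (m - 1) * d powi (- int n) * (d / \<gamma>) ^ j / fact j
            * of_nat (p choose l) * of_nat ((p - l) choose h)
            * pochhammer (1 - of_nat h + k) h
            * hurwitz_lerch z (of_nat h - k) v
            * of_int (signed_stirling1 j p))"
  proof (intro sum.cong)
    fix j p l h assume "j \<in> {0..n - 1}" "p \<in> {0..j}" "l \<in> {0..p}" "h \<in> {0..p - l}"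
    hence lj: "l \<le> j" by simp
    have "(- 1 :: complex) ^ (j - l) = (- 1) ^ j * (- 1) ^ l"
      using lj by (simp add: minus_one_power_iff)
    thus "d ^ j * T j p l h / d ^ n
        = (- 1) ^ (j - l) * (- 1) powr m * m ^ (p - l - h)
            * (2 * \<i> * pi) powr (1 - of_nat h + k)
            * \<gamma> powr (m - 1) * d powi (- int n) * (d / \<gamma>) ^ j / fact j
            * of_nat (p choose l) * of_nat ((p - l) choose h)
            * pochhammer (1 - of_nat h + k) h
            * hurwitz_lerch z (of_nat h - k) v
            * of_int (signed_stirling1 j p)"
      by (simp only: T_def power_int_minus power_int_of_nat power_divide divide_inverse
            inverse_mult_distrib power_mult_distrib power_inverse mult_ac)
  qed (use \<open>n > 0\<close> in auto)
  finally show ?thesis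
    using set_integral_Ioi_exp_substitution(1)[OF meas int]
    unfolding d_def z_def v_def vb_def by blast
qed

end
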